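(* For every field $\mathbb F$ of positive characteristic, $\mathcal S_{\mathbf{IM}(\mathbb F)}$ strictly dominates $\mathcal S_{\mathbf{WL}}$, i.e. $\mathcal S_{\mathbf{WL}}\preceq\mathcal S_{\mathbf{IM}(\mathbb F)}$ but $\mathcal S_{\mathbf{IM}(\mathbb F)}\not\preceq\mathcal S_{\mathbf{WL}}$.
   Context: All sets are finite. $[k]=\{1,\dots,k\}$; $[k]^{(r)}$ is the set of $r$-tuples of pairwise distinct elements of $[k]$. A labelled partition of $A$ is a function $\gamma:A\to L$; $\mathcal P(A)$ is the class of these. $\gamma\preceq\rho$ means $\rho(a)=\rho(b)\Rightarrow\gamma(a)=\gamma(b)$; $\gamma\approx\rho$ means both $\gamma\preceq\rho$ and $\rho\preceq\gamma$. For $\vec v\in V^k$, $\vec i\in[k]^{(r)}$, $\vec u\in V^r$, $\vec v\langle\vec i,\vec u\rangle$ is $\vec v$ with $u_s$ placed in position $i_s$ ($s\in[r]$). $\mathrm{pr}_t\gamma(w_1,\dots,w_t)=\gamma(w_1,\dots,w_t,w_t,\dots,w_t)$. A graph on $V$ is a labelled partition $\Gamma$ of $V^2$; $\alpha_{k,\Gamma}(\vec v)=(\Gamma(v_i,v_j))_{(i,j)\in[k]^{(2)}}$. A $k$-refinement operator $R$ maps each $\gamma\in\mathcal P(V^k)$ (any finite $V$) to $R\circ\gamma\in\mathcal P(V^k)$ with $\gamma\preceq R\circ\gamma$; $\gamma$ is $R$-stable if $\gamma\approx R\circ\gamma$; $[\gamma]^R$ is the first $R$-stable term of $X^0=\gamma$,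 $X^i=R\circ X^{i-1}$. For $\mathbf R=\{R_1,R_2,\dots\}$: $\overline R_1(\Gamma)=\Gamma$, $\overline R_k(\Gamma)=\mathrm{pr}_2[\alpha_{k,\Gamma}]^{R_k}$ ($k\ge2$), $\mathcal S_{\mathbf R}=\{\overline R_1,\overline R_2,\dots\}$. $\mathrm{WL}_1\circ\gamma=\gamma$ and for $k\ge2$, $\mathrm{WL}_k\circ\gamma(\vec v)=\big(\gamma(\vec v),\{\{(\gamma(\vec v\langle i,x\rangle))_{i\in[k]}:x\in V\}\}\big)$ (multiset); $\mathcal S_{\mathbf{WL}}=\mathcal S_{\{\mathrm{WL}_1,\mathrm{WL}_2,\dots\}}$. $\mathrm{IM}^{\mathbb F}_k\circ\gamma=\gamma$ for $k\le2$. For $k>2$, $\vec v\in V^k$, $\vec i\in[k]^{(2)}$, $\sigma\in\mathrm{Im}(\gamma)$, let $\chi^{\gamma,\vec v}_{\vec i,\sigma}\in\mathrm{Mat}_V(\mathbb F)$ have $(x,y)$-entry $1$ if $\gamma(\vec v\langle\vec i,(x,y)\rangle)=\sigma$ and $0$ otherwise; then $\mathrm{IM}^{\mathbb F}_k\circ\gamma(\vec u)=\mathrm{IM}^{\mathbb F}_k\circ\gamma(\vec v)$ iff $\gamma(\vec u)=\gamma(\vec v)$ and for each $\vec i\in[k]^{(2)}$ there is $S\in\mathrm{GL}_V(\mathbb F)$ with $S\chi^{\gamma,\vec u}_{\vec i,\sigma}S^{-1}=\chi^{\gamma,\vec v}_{\vec i,\sigma}$ for all $\sigma\in\mathrm{Im}(\gamma)$.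 $\mathcal S_{\mathbf{IM}(\mathbb F)}=\mathcal S_{\{\mathrm{IM}^{\mathbb F}_1,\mathrm{IM}^{\mathbb F}_2,\dots\}}$. For schemes $\mathcal S_X=\{X_k\}$, $\mathcal S_Y=\{Y_k\}$: $\mathcal S_Y\preceq\mathcal S_X$ if for every $k$ there is $k'$ with $Y_k(\Gamma)\preceq X_{k'}(\Gamma)$ for all graphs $\Gamma$.
   Formalization: Graphs are additionally required to have no label shared between a pair (u,u) and a pair (v,w) with v≠w; for arbitrary labelled partitions of V² the domination of WL by IM fails (e.g. in characteristic 2, two stars with 1 and 3 leaves whose diagonal carries the non-edge label). *)

theory Defs
  imports Complex_Main "HOL-Library.Multiset" "HOL-Library.Infinite_Typeclass"
begin

text \<open>
  Tuples are lists and positions are counted from 0, so \<open>[k]\<close> is \<open>{..<k}\<close>.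
  The finite vertex sets \<open>V\<close> range over the finite subsets of a type \<open>'v\<close>.
  A refinement operator has to return labels of the type it consumes, so all labelled
  partitions share one label type, which is closed under forming tuples and multisets.
  The constructor \<open>Atom\<close> supplies arbitrarily many basic labels. The constructor \<open>Class\<close>
  serves operators that are specified only by saying which tuples receive equal labels:
  the label is then the class itself.
\<close>

datatype 'v label =
    Atom nat
  | Tuple "'v label list"
  | Bag "'v label multiset"
  | Class "'v list set"

type_synonym 'v lpart = "'v list \<Rightarrow> 'v label"

definition tuples :: "'v set \<Rightarrow> nat \<Rightarrow> 'v list set" where
  "tuples V k = {v. length v = k \<and> set v \<subseteq> V}"

definition lp_le :: "'a set \<Rightarrow> ('a \<Rightarrow> 'l) \<Rightarrow> ('a \<Rightarrow> 'l) \<Rightarrow> bool" where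
  "lp_le A \<gamma> \<rho> \<longleftrightarrow> (\<forall>a\<in>A. \<forall>b\<in>A. \<rho> a = \<rho> b \<longrightarrow> \<gamma> a = \<gamma> b)"

definition lp_equiv :: "'a set \<Rightarrow> ('a \<Rightarrow> 'l) \<Rightarrow> ('a \<Rightarrow> 'l) \<Rightarrow> bool" where
  "lp_equiv A \<gamma> \<rho> \<longleftrightarrow> lp_le A \<gamma> \<rho> \<and> lp_le A \<rho> \<gamma>"

text \<open>
  In a graph given as a labelled partition of \<open>V\<^sup>2\<close>, the labels of the pairs \<open>(u,u)\<close> are the
  vertex colours and those of the pairs \<open>(v,w)\<close> with \<open>v \<noteq> w\<close> the arc colours; no vertex colour
  is an arc colour. This cannot be dropped, because the initial colouring \<open>alpha\<close> sees
  equality of vertices only through \<open>\<Gamma>\<close>. Take \<open>V = {a,x,b,y\<^sub>1,y\<^sub>2,y\<^sub>3}\<close> with edges \<open>ax\<close> and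
  \<open>by\<^sub>i\<close>, and give \<open>(u,u)\<close> the label of a non-edge. Over a field of characteristic 2, there is
  one invertible matrix which, for all cells \<open>S, T\<close> of \<open>{{a},{x},{b},{y\<^sub>1,y\<^sub>2,y\<^sub>3}}\<close>, conjugates the
  characteristic matrix of \<open>S \<times> T\<close> to that of the image of \<open>S \<times> T\<close> under the exchange of
  \<open>{a},{x}\<close> with \<open>{b},{y\<^sub>1,y\<^sub>2,y\<^sub>3}\<close>. So no invertible-map operator ever separates \<open>(a,a)\<close>
  from \<open>(b,b)\<close>, whereas the 2-dimensional Weisfeiler-Leman operator counts their neighbours.
\<close>

definition is_graph :: "'v set \<Rightarrow> 'v lpart \<Rightarrow> bool" where
  "is_graph V \<Gamma> \<longleftrightarrow> (\<forall>u\<in>V. \<forall>v\<in>V. \<forall>w\<in>V. v \<noteq> w \<longrightarrow> \<Gamma> [u, u] \<noteq> \<Gamma> [v, w])"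

definition alpha :: "nat \<Rightarrow> 'v lpart \<Rightarrow> 'v lpart" where
  "alpha k \<Gamma> v = Tuple [\<Gamma> [v ! i, v ! j]. i \<leftarrow> [0..<k], j \<leftarrow> [0..<k], i \<noteq> j]"

definition pr :: "nat \<Rightarrow> nat \<Rightarrow> 'v lpart \<Rightarrow> 'v lpart" where
  "pr k t \<gamma> w = \<gamma> (w @ replicate (k - t) (last w))"

type_synonym 'v operator = "'v set \<Rightarrow> 'v lpart \<Rightarrow> 'v lpart"

type_synonym 'v scheme = "nat \<Rightarrow> 'v set \<Rightarrow> 'v lpart \<Rightarrow> 'v lpart"

definition refinement_operator :: "nat \<Rightarrow> 'v operator \<Rightarrow> bool" where
  "refinement_operator k R \<longleftrightarrow> (\<forall>V \<gamma>. finite V \<longrightarrow> lp_le (tuples V k) \<gamma> (R V \<gamma>))"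

definition stable :: "nat \<Rightarrow> 'v operator \<Rightarrow> 'v set \<Rightarrow> 'v lpart \<Rightarrow> bool" where
  "stable k R V \<gamma> \<longleftrightarrow> lp_equiv (tuples V k) \<gamma> (R V \<gamma>)"

definition closure_under :: "nat \<Rightarrow> 'v operator \<Rightarrow> 'v set \<Rightarrow> 'v lpart \<Rightarrow> 'v lpart" where
  "closure_under k R V \<gamma> = (R V ^^ (LEAST n. stable k R V ((R V ^^ n) \<gamma>))) \<gamma>"

text \<open>Families of operators and schemes are indexed by \<open>k \<ge> 1\<close>; the value at 0 is never used.\<close>

definition scheme_of :: "(nat \<Rightarrow> 'v operator) \<Rightarrow> 'v scheme" where
  "scheme_of R k V \<Gamma> =
     (if k \<le> 1 then \<Gamma> else pr k 2 (closure_under k (R k) V (alpha k \<Gamma>)))"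

definition scheme_le :: "'v scheme \<Rightarrow> 'v scheme \<Rightarrow> bool" where
  "scheme_le Y X \<longleftrightarrow>
     (\<forall>k\<ge>1. \<exists>k'\<ge>1. \<forall>V \<Gamma>. finite V \<and> is_graph V \<Gamma> \<longrightarrow>
        lp_le (tuples V 2) (Y k V \<Gamma>) (X k' V \<Gamma>))"

definition WL :: "nat \<Rightarrow> 'v operator" where
  "WL k V \<gamma> = (if k \<le> 1 then \<gamma> else
     (\<lambda>v. Tuple [\<gamma> v, Bag {# Tuple (map (\<lambda>i. \<gamma> (v[i := x])) [0..<k]). x \<in># mset_set V #}]))"

definition S_WL :: "'v scheme" where
  "S_WL = scheme_of WL"

text \<open>\<open>V \<times> V\<close> matrices are functions vanishing outside \<open>V \<times> V\<close>.\<close>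

definition Mat :: "'v set \<Rightarrow> ('v \<Rightarrow> 'v \<Rightarrow> 'f::field) set" where
  "Mat V = {A. \<forall>x y. x \<notin> V \<or> y \<notin> V \<longrightarrow> A x y = 0}"

definition mat_mul ::
    "'v set \<Rightarrow> ('v \<Rightarrow> 'v \<Rightarrow> 'f::field) \<Rightarrow> ('v \<Rightarrow> 'v \<Rightarrow> 'f) \<Rightarrow> ('v \<Rightarrow> 'v \<Rightarrow> 'f)" where
  "mat_mul V A B = (\<lambda>x y. if x \<in> V \<and> y \<in> V then \<Sum>z\<in>V. A x z * B z y else 0)"

definition mat_one :: "'v set \<Rightarrow> ('v \<Rightarrow> 'v \<Rightarrow> 'f::field)" where
  "mat_one V = (\<lambda>x y. if x \<in> V \<and> x = y then 1 else 0)"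

definition mat_inverses ::
    "'v set \<Rightarrow> ('v \<Rightarrow> 'v \<Rightarrow> 'f::field) \<Rightarrow> ('v \<Rightarrow> 'v \<Rightarrow> 'f) \<Rightarrow> bool" where
  "mat_inverses V S S' \<longleftrightarrow>
     S \<in> Mat V \<and> S' \<in> Mat V \<and> mat_mul V S S' = mat_one V \<and> mat_mul V S' S = mat_one V"

definition chi ::
    "'v set \<Rightarrow> 'v lpart \<Rightarrow> 'v list \<Rightarrow> nat \<Rightarrow> nat \<Rightarrow> 'v label \<Rightarrow> ('v \<Rightarrow> 'v \<Rightarrow> 'f::field)" where
  "chi V \<gamma> v i j \<sigma> = (\<lambda>x y. if x \<in> V \<and> y \<in> V \<and> \<gamma> (v[i := x, j := y]) = \<sigma> then 1 else 0)"

definition im_equiv ::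
    "'f::field itself \<Rightarrow> nat \<Rightarrow> 'v set \<Rightarrow> 'v lpart \<Rightarrow> 'v list \<Rightarrow> 'v list \<Rightarrow> bool" where
  "im_equiv F k V \<gamma> u v \<longleftrightarrow> \<gamma> u = \<gamma> v \<and>
     (\<forall>i<k. \<forall>j<k. i \<noteq> j \<longrightarrow>
        (\<exists>(S :: 'v \<Rightarrow> 'v \<Rightarrow> 'f) S'. mat_inverses V S S' \<and>
           (\<forall>\<sigma> \<in> \<gamma> ` tuples V k.
              mat_mul V (mat_mul V S (chi V \<gamma> u i j \<sigma>)) S' = chi V \<gamma> v i j \<sigma>)))"

definition IM :: "'f::field itself \<Rightarrow> nat \<Rightarrow> 'v operator" where
  "IM F k V \<gamma> = (if k \<le> 2 then \<gamma> else (\<lambda>v. Class {u \<in> tuples V k. im_equiv F k V \<gamma> u v}))"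

definition S_IM :: "'f::field itself \<Rightarrow> 'v scheme" where
  "S_IM F = scheme_of (IM F)"

lemma mat_mul_in_Mat: "mat_mul V A B \<in> Mat V"
  by (auto simp: Mat_def mat_mul_def)

lemma chi_in_Mat: "chi V \<gamma> v i j \<sigma> \<in> Mat V"
  by (auto simp: Mat_def chi_def)

lemma mat_one_in_Mat: "mat_one V \<in> Mat V"
  by (auto simp: Mat_def mat_one_def)

lemma mat_mul_assoc:
  assumes "finite V"
  shows "mat_mul V (mat_mul V A B) C = mat_mul V A (mat_mul V B C)"
proof (intro ext)
  fix x y
  have "(\<Sum>z\<in>V. (\<Sum>w\<in>V. A x w * B w z) * C z y) = (\<Sum>z\<in>V. \<Sum>w\<in>V. A x w * (B w z * C z y))"
    by (simp add: sum_distrib_right mult.assoc)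
  also have "\<dots> = (\<Sum>w\<in>V. \<Sum>z\<in>V. A x w * (B w z * C z y))"
    by (rule sum.swap)
  also have "\<dots> = (\<Sum>w\<in>V. A x w * (\<Sum>z\<in>V. B w z * C z y))"
    by (simp add: sum_distrib_left)
  finally show "mat_mul V (mat_mul V A B) C x y = mat_mul V A (mat_mul V B C) x y"
    by (simp add: mat_mul_def)
qed

lemma mat_mul_one_left:
  assumes "finite V" "A \<in> Mat V"
  shows "mat_mul V (mat_one V) A = A"
proof (intro ext)
  fix x y
  have "(\<Sum>z\<in>V. mat_one V x z * A z y) = (\<Sum>z\<in>V. if z = x then A z y else 0)" if "x \<in> V"
    using that by (intro sum.cong) (auto simp: mat_one_def)
  then show "mat_mul V (mat_one V) A x y = A x y"
    using assms by (auto simp: mat_mul_def Mat_def sum.delta)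
qed

lemma mat_mul_one_right:
  assumes "finite V" "A \<in> Mat V"
  shows "mat_mul V A (mat_one V) = A"
proof (intro ext)
  fix x y
  have "(\<Sum>z\<in>V. A x z * mat_one V z y) = (\<Sum>z\<in>V. if z = y then A x z else 0)"
    by (intro sum.cong) (auto simp: mat_one_def)
  then show "mat_mul V A (mat_one V) x y = A x y"
    using assms by (auto simp: mat_mul_def Mat_def sum.delta)
qed

lemma im_equiv_refl:
  assumes "finite V"
  shows "im_equiv (F :: 'f::field itself) k V \<gamma> v v"
  unfolding im_equiv_def mat_inverses_def
  using assms
  by (auto intro!: exI[of _ "mat_one V"]
      simp: mat_one_in_Mat mat_mul_one_left mat_mul_one_right chi_in_Mat)

lemma im_equiv_sym:
  assumes V: "finite V" and uv: "im_equiv (F :: 'f::field itself) k V \<gamma> u v"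
  shows "im_equiv F k V \<gamma> v u"
  unfolding im_equiv_def
proof (intro conjI allI impI)
  show "\<gamma> v = \<gamma> u" using uv by (simp add: im_equiv_def)
  fix i j assume "i < k" "j < k" "i \<noteq> j"
  then obtain S S' :: "'a \<Rightarrow> 'a \<Rightarrow> 'f" where S: "mat_inverses V S S'"
    and eq: "\<And>\<sigma>. \<sigma> \<in> \<gamma> ` tuples V k \<Longrightarrow>
      mat_mul V (mat_mul V S (chi V \<gamma> u i j \<sigma>)) S' = chi V \<gamma> v i j \<sigma>"
    using uv unfolding im_equiv_def by meson
  have "mat_mul V (mat_mul V S' (chi V \<gamma> v i j \<sigma>)) S = chi V \<gamma> u i j \<sigma>"
    if "\<sigma> \<in> \<gamma> ` tuples V k" for \<sigma>
  proof -
    have "mat_mul V (mat_mul V S' (chi V \<gamma> v i j \<sigma>)) S =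
        mat_mul V (mat_mul V (mat_mul V S' S) (chi V \<gamma> u i j \<sigma>)) (mat_mul V S' S)"
      using V by (simp add: eq[OF that, symmetric] mat_mul_assoc)
    then show ?thesis
      using S V by (simp add: mat_inverses_def mat_mul_one_left mat_mul_one_right chi_in_Mat)
  qed
  moreover have "mat_inverses V S' S" using S by (simp add: mat_inverses_def)
  ultimately show "\<exists>(S :: 'a \<Rightarrow> 'a \<Rightarrow> 'f) S'. mat_inverses V S S' \<and>
      (\<forall>\<sigma> \<in> \<gamma> ` tuples V k.
        mat_mul V (mat_mul V S (chi V \<gamma> v i j \<sigma>)) S' = chi V \<gamma> u i j \<sigma>)"
    by blast
qed

lemma im_equiv_trans:
  assumes V: "finite V" and uv: "im_equiv (F :: 'f::field itself) k V \<gamma> u v"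
    and vw: "im_equiv F k V \<gamma> v w"
  shows "im_equiv F k V \<gamma> u w"
  unfolding im_equiv_def
proof (intro conjI allI impI)
  show "\<gamma> u = \<gamma> w" using uv vw by (simp add: im_equiv_def)
  fix i j assume ij: "i < k" "j < k" "i \<noteq> j"
  obtain S S' :: "'a \<Rightarrow> 'a \<Rightarrow> 'f" where S: "mat_inverses V S S'"
    and eqS: "\<And>\<sigma>. \<sigma> \<in> \<gamma> ` tuples V k \<Longrightarrow>
      mat_mul V (mat_mul V S (chi V \<gamma> u i j \<sigma>)) S' = chi V \<gamma> v i j \<sigma>"
    using uv ij unfolding im_equiv_def by meson
  obtain T T' :: "'a \<Rightarrow> 'a \<Rightarrow> 'f" where T: "mat_inverses V T T'"
    and eqT: "\<And>\<sigma>. \<sigma> \<in> \<gamma> ` tuples V k \<Longrightarrow>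
      mat_mul V (mat_mul V T (chi V \<gamma> v i j \<sigma>)) T' = chi V \<gamma> w i j \<sigma>"
    using vw ij unfolding im_equiv_def by meson
  have "mat_mul V (mat_mul V T S) (mat_mul V S' T') =
      mat_mul V T (mat_mul V (mat_mul V S S') T')"
    using V by (simp add: mat_mul_assoc)
  moreover have "mat_mul V (mat_mul V S' T') (mat_mul V T S) =
      mat_mul V S' (mat_mul V (mat_mul V T' T) S)"
    using V by (simp add: mat_mul_assoc)
  ultimately have "mat_inverses V (mat_mul V T S) (mat_mul V S' T')"
    using S T V by (simp add: mat_inverses_def mat_mul_in_Mat mat_mul_one_left)
  moreover have "mat_mul V (mat_mul V (mat_mul V T S) (chi V \<gamma> u i j \<sigma>)) (mat_mul V S' T') =
      chi V \<gamma> w i j \<sigma>" if "\<sigma> \<in> \<gamma> ` tuples V k" for \<sigma>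
    using V by (simp add: eqT[OF that, symmetric] eqS[OF that, symmetric] mat_mul_assoc)
  ultimately show "\<exists>(S :: 'a \<Rightarrow> 'a \<Rightarrow> 'f) S'. mat_inverses V S S' \<and>
      (\<forall>\<sigma> \<in> \<gamma> ` tuples V k.
        mat_mul V (mat_mul V S (chi V \<gamma> u i j \<sigma>)) S' = chi V \<gamma> w i j \<sigma>)"
    by blast
qed

lemma IM_eq_iff:
  assumes "finite V" "k > 2" "u \<in> tuples V k" "v \<in> tuples V k"
  shows "IM F k V \<gamma> u = IM F k V \<gamma> v \<longleftrightarrow> im_equiv F k V \<gamma> u v"
proof
  assume "IM F k V \<gamma> u = IM F k V \<gamma> v"
  then have "u \<in> {w \<in> tuples V k. im_equiv F k V \<gamma> w v}"
    using assms im_equiv_refl[OF assms(1), of F k \<gamma> u] by (simp add: IM_def) blast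
  then show "im_equiv F k V \<gamma> u v" by simp
next
  assume "im_equiv F k V \<gamma> u v"
  then show "IM F k V \<gamma> u = IM F k V \<gamma> v"
    using assms(1,2) by (auto simp: IM_def intro: im_equiv_trans im_equiv_sym)
qed

lemma refinement_operator_WL: "refinement_operator k (WL k)"
  by (auto simp: refinement_operator_def lp_le_def WL_def)

lemma refinement_operator_IM: "refinement_operator k (IM F k)"
proof (cases "k \<le> 2")
  case True
  then show ?thesis by (auto simp: refinement_operator_def lp_le_def IM_def)
next
  case False
  then show ?thesis
    by (auto simp: refinement_operator_def lp_le_def IM_eq_iff im_equiv_def)
qed

end

theory Submission
  imports Defs "HOL-Library.Function_Algebras"
begin

text \<open>
  Invertible maps dominate Weisfeiler-Leman because the characteristic matrix of a label that
  forces two coordinates to agree is a diagonal 0/1 matrix: similarity preserves its rank, and the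
  rank is the exact number of extensions, whatever the characteristic. Two spare coordinates
  suffice to carry out a round of the counting game.

  For strictness, take the Cai-Furer-Immerman construction over a complete bipartite graph with
  values in the prime field of \<open>'f\<close>, as the union of an uncharged and a charged copy. A game with
  fewer pebbles than base vertices on each side cannot locate the charge, since the defect can
  always be moved along an edge to an unpebbled gadget. But prime field values are themselves
  scalars of \<open>'f\<close>, so the sums \<open>a j + b i\<close> that label the arcs become entries of an intertwined
  matrix, and the linear equations that tie the entries to the charges make an invertible
  intertwiner between the two copies impossible.
\<close>

section \<open>Weisfeiler-Leman below invertible maps\<close>

lemma lp_le_refl: "lp_le A \<gamma> \<gamma>"
  by (simp add: lp_le_def)

lemma lp_le_trans: "lp_le A \<gamma> \<rho> \<Longrightarrow> lp_le A \<rho> \<tau> \<Longrightarrow> lp_le A \<gamma> \<tau>"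
  unfolding lp_le_def by blast

lemma lp_leD: "lp_le A \<gamma> \<rho> \<Longrightarrow> a \<in> A \<Longrightarrow> b \<in> A \<Longrightarrow> \<rho> a = \<rho> b \<Longrightarrow> \<gamma> a = \<gamma> b"
  unfolding lp_le_def by blast

lemma tuples_update: "u \<in> tuples V k \<Longrightarrow> x \<in> V \<Longrightarrow> u[i := x] \<in> tuples V k"
  unfolding tuples_def using set_update_subset_insert[of u i x] by auto

lemma tuples_nth: "u \<in> tuples V k \<Longrightarrow> i < k \<Longrightarrow> u ! i \<in> V"
  by (auto simp: tuples_def)

lemma finite_tuples: "finite V \<Longrightarrow> finite (tuples V k)"
  unfolding tuples_def using finite_lists_length_eq[of V k] by (metis (no_types, lifting) Collect_cong)

lemma lp_le_iterate:
  assumes "refinement_operator k R" "finite V"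
  shows "lp_le (tuples V k) \<gamma> ((R V ^^ n) \<gamma>)"
proof (induction n)
  case 0
  show ?case by (simp add: lp_le_refl)
next
  case (Suc n)
  moreover have "lp_le (tuples V k) ((R V ^^ n) \<gamma>) ((R V ^^ Suc n) \<gamma>)"
    using assms by (simp add: refinement_operator_def)
  ultimately show ?case by (rule lp_le_trans)
qed

lemma lp_le_closure_under:
  assumes "refinement_operator k R" "finite V"
  shows "lp_le (tuples V k) \<gamma> (closure_under k R V \<gamma>)"
  unfolding closure_under_def using assms by (rule lp_le_iterate)

text \<open>An iterate whose kernel has minimal size is not properly refined by the next one. So
  some iterate is stable, and the \<open>LEAST\<close> in \<open>closure_under\<close> is
  attained.\<close>

lemma stable_closure_under:
  assumes R: "refinement_operator k R" and V: "finite V"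
  shows "stable k R V (closure_under k R V \<gamma>)"
proof -
  define X where "X n = (R V ^^ n) \<gamma>" for n
  define E where "E n = {(a, b). a \<in> tuples V k \<and> b \<in> tuples V k \<and> X n a = X n b}" for n
  obtain n where n: "\<And>m. card (E n) \<le> card (E m)"
    using ex_has_least_nat[of "\<lambda>_. True" 0 "\<lambda>n. card (E n)"] by auto
  have step: "lp_le (tuples V k) (X n) (X (Suc n))"
    using R V by (simp add: X_def refinement_operator_def)
  have "finite (E n)"
    by (rule finite_subset[of _ "tuples V k \<times> tuples V k"])
      (auto simp: E_def finite_tuples V)
  moreover have "E (Suc n) \<subseteq> E n"
    using step by (auto simp: E_def lp_le_def)
  ultimately have "E (Suc n) = E n"
    using n by (metis card_seteq)
  then have "lp_le (tuples V k) (X (Suc n)) (X n)"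
    unfolding E_def lp_le_def by blast
  with step have "stable k R V (X n)"
    by (simp add: stable_def lp_equiv_def X_def)
  then show ?thesis
    unfolding closure_under_def X_def by (rule LeastI)
qed

lemma alpha_eq_iff:
  "alpha k \<Gamma> u = alpha k \<Gamma> v \<longleftrightarrow>
    (\<forall>i<k. \<forall>j<k. i \<noteq> j \<longrightarrow> \<Gamma> [u ! i, u ! j] = \<Gamma> [v ! i, v ! j])"
proof -
  have "alpha k \<Gamma> w = Tuple (map (\<lambda>(i, j). \<Gamma> [w ! i, w ! j])
      [(i, j). i \<leftarrow> [0..<k], j \<leftarrow> [0..<k], i \<noteq> j])" for w
    by (simp add: alpha_def map_concat comp_def if_distrib cong: if_cong)
  then show ?thesis
    by auto
qed

text \<open>\<open>is_graph\<close> keeps vertex colours apart from arc colours, which makes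
  coincidences of entries visible in \<open>alpha\<close>.\<close>

lemma alpha_nth_eq_iff:
  assumes "is_graph V \<Gamma>" "u \<in> tuples V k" "v \<in> tuples V k" "alpha k \<Gamma> u = alpha k \<Gamma> v"
    and "i < k" "j < k"
  shows "u ! i = u ! j \<longleftrightarrow> v ! i = v ! j"
proof (cases "i = j")
  case False
  then have "\<Gamma> [u ! i, u ! j] = \<Gamma> [v ! i, v ! j]"
    using assms by (auto simp: alpha_eq_iff)
  moreover have "u ! i \<in> V" "u ! j \<in> V" "v ! i \<in> V" "v ! j \<in> V"
    using assms by (auto intro: tuples_nth)
  ultimately show ?thesis
    using assms(1) unfolding is_graph_def by metis
qed simp

section \<open>Multisets of labels and monotonicity of Weisfeiler-Leman refinement\<close>

lemma image_mset_eq_transfer: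
  assumes eq: "image_mset f M = image_mset g N"
    and cross: "\<And>x y. x \<in># M \<Longrightarrow> y \<in># N \<Longrightarrow> f x = g y \<Longrightarrow> f' x = g' y"
  shows "image_mset f' M = image_mset g' N"
proof -
  \<comment> \<open>\<open>Q\<close> reads the new value off the old one through an arbitrary
    representative; \<open>cross\<close> makes the choice immaterial.\<close>
  define Q where "Q l = f' (SOME x. x \<in># M \<and> f x = l)" for l
  have im: "f ` set_mset M = g ` set_mset N"
    using eq by (metis set_image_mset)
  have Q: "Q (g y) = g' y" if "y \<in># N" for y
  proof -
    have "\<exists>x. x \<in># M \<and> f x = g y" using im that by (metis imageE imageI)
    then have "(SOME x. x \<in># M \<and> f x = g y) \<in># M \<and> f (SOME x. x \<in># M \<and> f x = g y) = g y"
      by (rule someI_ex)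
    then show ?thesis using cross that by (simp add: Q_def)
  qed
  have "Q (f x) = f' x" if x: "x \<in># M" for x
  proof -
    obtain y where "y \<in># N" "f x = g y" using im x by (metis imageE imageI)
    then show ?thesis using Q cross x by metis
  qed
  then have "image_mset f' M = image_mset Q (image_mset f M)"
    by (auto simp: multiset.map_comp intro: image_mset_cong)
  also have "\<dots> = image_mset g' N"
    unfolding eq using Q by (auto simp: multiset.map_comp intro: image_mset_cong)
  finally show ?thesis .
qed

lemma WL_mono:
  assumes V: "finite V" and le: "lp_le (tuples V k) \<gamma> \<rho>"
  shows "lp_le (tuples V k) (WL k V \<gamma>) (WL k V \<rho>)"
proof (cases "k \<le> 1")
  case True
  then show ?thesis using le by (simp add: WL_def)
next
  case False
  show ?thesis
    unfolding lp_le_def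
  proof (intro ballI impI)
    fix u v assume uv: "u \<in> tuples V k" "v \<in> tuples V k" "WL k V \<rho> u = WL k V \<rho> v"
    let ?T = "\<lambda>\<gamma> u x. Tuple (map (\<lambda>i. \<gamma> (u[i := x])) [0..<k])"
    have "image_mset (?T \<rho> u) (mset_set V) = image_mset (?T \<rho> v) (mset_set V)"
      using uv False by (simp add: WL_def)
    then have "image_mset (?T \<gamma> u) (mset_set V) = image_mset (?T \<gamma> v) (mset_set V)"
    proof (rule image_mset_eq_transfer)
      fix x y assume "x \<in># mset_set V" "y \<in># mset_set V" "?T \<rho> u x = ?T \<rho> v y"
      then show "?T \<gamma> u x = ?T \<gamma> v y"
        using uv(1,2) V by (auto intro!: lp_leD[OF le] tuples_update)
    qed
    moreover have "\<gamma> u = \<gamma> v"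
      using uv False by (intro lp_leD[OF le]) (auto simp: WL_def)
    ultimately show "WL k V \<gamma> u = WL k V \<gamma> v"
      using False by (simp add: WL_def)
  qed
qed

text \<open>By monotonicity, no iterate starting below a stable \<open>\<rho>\<close> can become
  finer than \<open>\<rho>\<close>.\<close>

lemma closure_under_WL_le:
  assumes V: "finite V" and le: "lp_le (tuples V k) \<gamma> \<rho>"
    and st: "lp_le (tuples V k) (WL k V \<rho>) \<rho>"
  shows "lp_le (tuples V k) (closure_under k (WL k) V \<gamma>) \<rho>"
proof -
  have "lp_le (tuples V k) ((WL k V ^^ n) \<gamma>) \<rho>" for n
  proof (induction n)
    case 0
    show ?case using le by simp
  next
    case (Suc n)
    show ?case using lp_le_trans[OF WL_mono[OF V Suc] st] by simp
  qed
  then show ?thesis by (simp add: closure_under_def)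
qed

section \<open>Rank arguments for similar diagonal matrices\<close>

lemma card_le_of_left_inverse:
  fixes L R :: "'b \<Rightarrow> 'c \<Rightarrow> 'f::field"
  assumes A: "finite A" and B: "finite B"
    and inv: "\<And>a a'. a \<in> A \<Longrightarrow> a' \<in> A \<Longrightarrow> (\<Sum>b\<in>B. L a b * R a' b) = (if a = a' then 1 else 0)"
  shows "card A \<le> card B"
proof -
  define sc where "sc = (\<lambda>(c::'f) (f::'c \<Rightarrow> 'f) x. c * f x)"
  interpret vs: vector_space sc
    by standard (auto simp: sc_def algebra_simps)
  \<comment> \<open>Cut down to \<open>B\<close>, the rows of \<open>R\<close> lie in the span of
    the unit vectors of \<open>B\<close>, while pairing with \<open>L\<close> makes them
    independent.\<close>
  define w where "w a = (\<lambda>x. if x \<in> B then R a x else 0)" for a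
  define e where "e b = (\<lambda>x. if x = b then 1 else 0 :: 'f)" for b :: 'c
  have fun_sum: "(\<Sum>a\<in>I. f a) x = (\<Sum>a\<in>I. f a x)" for f :: "'d \<Rightarrow> 'c \<Rightarrow> 'f" and I x
    by (induction I rule: infinite_finite_induct) auto
  have pair: "(\<Sum>b\<in>B. L a b * w a' b) = (if a = a' then 1 else 0)" if "a \<in> A" "a' \<in> A" for a a'
    using inv[OF that] by (simp add: w_def cong: sum.cong)
  have inj: "inj_on w A"
    by (rule inj_onI) (metis pair zero_neq_one)
  have "vs.independent (w ` A)"
    unfolding vs.dependent_finite[OF finite_imageI[OF A]]
  proof (clarsimp)
    fix u a assume s: "(\<Sum>v\<in>w ` A. sc (u v) v) = 0" and a: "a \<in> A" "u (w a) \<noteq> 0"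
    have "(\<Sum>a'\<in>A. sc (u (w a')) (w a')) = 0"
      using s by (simp add: sum.reindex[OF inj])
    then have "(\<Sum>a'\<in>A. u (w a') * w a' b) = 0" for b
      by (auto dest: fun_cong[of _ _ b] simp: fun_sum sc_def)
    then have "0 = (\<Sum>b\<in>B. L a b * (\<Sum>a'\<in>A. u (w a') * w a' b))"
      by simp
    also have "\<dots> = (\<Sum>b\<in>B. \<Sum>a'\<in>A. u (w a') * (L a b * w a' b))"
      by (simp add: sum_distrib_left mult_ac)
    also have "\<dots> = (\<Sum>a'\<in>A. u (w a') * (\<Sum>b\<in>B. L a b * w a' b))"
      by (subst sum.swap) (simp add: sum_distrib_left)
    also have "\<dots> = (\<Sum>a'\<in>A. if a' = a then u (w a') else 0)"
      using a by (intro sum.cong) (auto simp: pair)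
    also have "\<dots> = u (w a)"
      using a A by (simp add: sum.delta)
    finally show False using a by simp
  qed
  moreover have "w ` A \<subseteq> vs.span (e ` B)"
  proof clarify
    fix a assume "a \<in> A"
    have "w a = (\<Sum>b\<in>B. sc (R a b) (e b))"
      using B by (auto simp: fun_eq_iff fun_sum sc_def e_def w_def if_distrib sum.delta cong: if_cong)
    then show "w a \<in> vs.span (e ` B)"
      by (auto intro!: vs.span_sum vs.span_scale intro: vs.span_base)
  qed
  ultimately have "card (w ` A) \<le> card (e ` B)"
    using vs.independent_span_bound[of "e ` B" "w ` A"] B by auto
  then show ?thesis
    using card_image[OF inj] card_image_le[OF B, of e] by linarith
qed

lemma mat_conj_intertwines:
  assumes V: "finite V" and S: "mat_inverses V S S'" and M: "M \<in> Mat V" "N \<in> Mat V"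
    and eq: "mat_mul V (mat_mul V S M) S' = N" and xy: "x \<in> V" "y \<in> V"
  shows "(\<Sum>z\<in>V. S x z * M z y) = (\<Sum>z\<in>V. N x z * S z y)"
proof -
  have "mat_mul V N S = mat_mul V S M"
    using V S M unfolding eq[symmetric]
    by (simp add: mat_inverses_def mat_mul_assoc mat_mul_one_right)
  then have "mat_mul V N S x y = mat_mul V S M x y" by simp
  then show ?thesis
    using xy by (simp add: mat_mul_def)
qed

text \<open>The columns of \<open>S\<close> indexed by \<open>A\<close> are supported on
  \<open>B\<close>, so restricting \<open>S' S = 1\<close> to \<open>A\<close> factors an identity
  of size \<open>card A\<close> through \<open>B\<close>.\<close>

lemma card_le_of_diag_conj:
  fixes S S' :: "'v \<Rightarrow> 'v \<Rightarrow> 'f::field"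
  assumes V: "finite V" and S: "mat_inverses V S S'" and AB: "A \<subseteq> V" "B \<subseteq> V"
    and eq: "mat_mul V (mat_mul V S (\<lambda>x y. if x = y \<and> x \<in> A then 1 else 0)) S' =
      (\<lambda>x y. if x = y \<and> x \<in> B then 1 else 0)"
  shows "card A \<le> card B"
proof (rule card_le_of_left_inverse[where L = S' and R = "\<lambda>a x. S x a"])
  show "finite A" "finite B" using V AB by (auto intro: finite_subset)
  fix a a' assume a: "a \<in> A" "a' \<in> A"
  have supp: "S x a' = 0" if "x \<in> V" "x \<notin> B" for x
  proof -
    have "(\<Sum>z\<in>V. S x z * (if z = a' \<and> z \<in> A then 1 else 0)) =
        (\<Sum>z\<in>V. (if x = z \<and> x \<in> B then 1 else 0) * S z a')"
      by (rule mat_conj_intertwines[OF V S _ _ eq]) (use AB a that in \<open>auto simp: Mat_def\<close>)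
    moreover have "(\<Sum>z\<in>V. S x z * (if z = a' \<and> z \<in> A then 1 else 0)) =
        (\<Sum>z\<in>V. if z = a' then S x z else 0)"
      by (rule sum.cong) (use a in auto)
    ultimately show ?thesis using a AB V that by (auto simp: sum.delta)
  qed
  have "mat_mul V S' S a a' = mat_one V a a'"
    using S by (simp add: mat_inverses_def)
  then have "(\<Sum>x\<in>V. S' a x * S x a') = (if a = a' then 1 else 0)"
    using a AB by (auto simp: mat_mul_def mat_one_def split: if_splits)
  moreover have "(\<Sum>x\<in>B. S' a x * S x a') = (\<Sum>x\<in>V. S' a x * S x a')"
    using supp AB V by (intro sum.mono_neutral_left) auto
  ultimately show "(\<Sum>x\<in>B. S' a x * S x a') = (if a = a' then 1 else 0)" by simp
qed

section \<open>Partitions stable under invertible maps\<close>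

lemma stable_IM_im_equiv:
  assumes "finite V" "k > 2" "stable k (IM F k) V \<gamma>"
    and "u \<in> tuples V k" "v \<in> tuples V k" "\<gamma> u = \<gamma> v"
  shows "im_equiv F k V \<gamma> u v"
proof -
  have "lp_le (tuples V k) (IM F k V \<gamma>) \<gamma>"
    using assms(3) by (simp add: stable_def lp_equiv_def)
  then have "IM F k V \<gamma> u = IM F k V \<gamma> v"
    using assms(4-6) by (rule lp_leD)
  then show ?thesis by (simp add: IM_eq_iff[OF assms(1,2,4,5)])
qed

locale im_stable_graph =
  fixes F :: "'f::field itself" and k :: nat and V :: "'v set" and \<Gamma> \<gamma> :: "'v lpart"
  assumes V: "finite V" and k: "k > 2" and graph: "is_graph V \<Gamma>"
    and stable: "stable k (IM F k) V \<gamma>" and alpha_le: "lp_le (tuples V k) (alpha k \<Gamma>) \<gamma>"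
begin

lemma nth_eq_iff:
  assumes "u \<in> tuples V k" "v \<in> tuples V k" "\<gamma> u = \<gamma> v" "i < k" "j < k"
  shows "u ! i = u ! j \<longleftrightarrow> v ! i = v ! j"
  by (rule alpha_nth_eq_iff[OF graph assms(1,2) lp_leD[OF alpha_le assms(1-3)] assms(4,5)])

lemma conj_chi:
  assumes "u \<in> tuples V k" "v \<in> tuples V k" "\<gamma> u = \<gamma> v" "i < k" "j < k" "i \<noteq> j"
  obtains S S' :: "'v \<Rightarrow> 'v \<Rightarrow> 'f" where "mat_inverses V S S'"
    "\<And>\<sigma>. \<sigma> \<in> \<gamma> ` tuples V k \<Longrightarrow>
      mat_mul V (mat_mul V S (chi V \<gamma> u i j \<sigma>)) S' = chi V \<gamma> v i j \<sigma>"
proof -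
  have "im_equiv F k V \<gamma> u v"
    by (rule stable_IM_im_equiv[OF V k stable assms(1-3)])
  then show thesis
    using assms(4-6) that unfolding im_equiv_def by meson
qed

text \<open>Back-and-forth for two coordinates at once: a label missing among the extensions of
  \<open>v\<close> has characteristic matrix zero, and only zero is similar to zero.\<close>

lemma label_extends:
  assumes u: "u \<in> tuples V k" and v: "v \<in> tuples V k" and eq: "\<gamma> u = \<gamma> v"
    and ij: "i < k" "j < k" "i \<noteq> j" and xy: "x \<in> V" "y \<in> V"
  shows "\<exists>x'\<in>V. \<exists>y'\<in>V. \<gamma> (v[i := x', j := y']) = \<gamma> (u[i := x, j := y])"
proof (rule ccontr)
  assume neg: "\<not> ?thesis"
  let ?\<sigma> = "\<gamma> (u[i := x, j := y])"
  obtain S S' :: "'v \<Rightarrow> 'v \<Rightarrow> 'f" where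
    conj: "\<And>\<sigma>. \<sigma> \<in> \<gamma> ` tuples V k \<Longrightarrow>
      mat_mul V (mat_mul V S (chi V \<gamma> v i j \<sigma>)) S' = chi V \<gamma> u i j \<sigma>"
    using conj_chi[OF v u eq[symmetric] ij] by blast
  have zero: "chi V \<gamma> v i j ?\<sigma> = (\<lambda>_ _. 0 :: 'f)"
    using neg by (auto simp: chi_def fun_eq_iff)
  have "?\<sigma> \<in> \<gamma> ` tuples V k" using u xy by (auto intro!: imageI tuples_update)
  from conj[OF this, symmetric] have "chi V \<gamma> u i j ?\<sigma> x y = (0 :: 'f)"
    by (simp add: zero mat_mul_def)
  then show False using xy by (simp add: chi_def)
qed

text \<open>A label shows that entry \<open>m\<close> is repeated, so the extension of
  \<open>v\<close> found by \<open>label_extends\<close> has to repeat it as well.\<close>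

lemma label_copy:
  assumes u: "u \<in> tuples V k" and v: "v \<in> tuples V k" and eq: "\<gamma> u = \<gamma> v"
    and ij: "i < k" "j < k" "i \<noteq> j" and m: "m < k" "m \<noteq> i" "m \<noteq> j"
  shows "\<gamma> (u[i := u ! m, j := u ! m]) = \<gamma> (v[i := v ! m, j := v ! m])"
proof -
  have um: "u ! m \<in> V" using u m by (rule_tac tuples_nth)
  obtain x y where xy: "x \<in> V" "y \<in> V"
    and \<sigma>: "\<gamma> (v[i := x, j := y]) = \<gamma> (u[i := u ! m, j := u ! m])"
    using label_extends[OF u v eq ij um um] by blast
  have t: "u[i := u ! m, j := u ! m] \<in> tuples V k" "v[i := x, j := y] \<in> tuples V k"
    using u v um xy by (auto intro!: tuples_update)
  have len: "length u = k" "length v = k" using u v by (auto simp: tuples_def)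
  have "x = v ! m" using nth_eq_iff[OF t \<sigma>[symmetric] ij(1) m(1)] ij m len by simp
  moreover have "y = v ! m" using nth_eq_iff[OF t \<sigma>[symmetric] ij(2) m(1)] ij m len by simp
  ultimately show ?thesis using \<sigma> by simp
qed

text \<open>The labels of tuples whose entries at \<open>i\<close> and \<open>j\<close> agree have diagonal characteristic
  matrices, and the rank of those counts exactly, even though traces only count modulo the
  characteristic.\<close>

lemma card_diagonal_le:
  assumes u: "u \<in> tuples V k" and v: "v \<in> tuples V k" and eq: "\<gamma> u = \<gamma> v"
    and ij: "i < k" "j < k" "i \<noteq> j"
  shows "card {x \<in> V. \<gamma> (u[i := x, j := x]) = \<sigma>} \<le> card {x \<in> V. \<gamma> (v[i := x, j := x]) = \<sigma>}"
proof (cases "\<exists>x\<in>V. \<gamma> (u[i := x, j := x]) = \<sigma>")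
  case False
  then have "{x \<in> V. \<gamma> (u[i := x, j := x]) = \<sigma>} = {}" by auto
  then show ?thesis by (metis card.empty le0)
next
  case True
  then obtain a where a: "a \<in> V" "\<gamma> (u[i := a, j := a]) = \<sigma>" by auto
  have ta: "u[i := a, j := a] \<in> tuples V k"
    using u a by (auto intro!: tuples_update)
  \<comment> \<open>One tuple of label \<open>\<sigma>\<close> has equal entries at \<open>i\<close>
    and \<open>j\<close>, hence all of them do.\<close>
  have diag: "chi V \<gamma> w i j \<sigma> =
      (\<lambda>x y. if x = y \<and> x \<in> {x \<in> V. \<gamma> (w[i := x, j := x]) = \<sigma>} then 1 else 0 :: 'f)"
    if w: "w \<in> tuples V k" for w
  proof -
    have "x = y" if "x \<in> V" "y \<in> V" "\<gamma> (w[i := x, j := y]) = \<sigma>" for x y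
    proof -
      have "w[i := x, j := y] \<in> tuples V k" using w that by (auto intro!: tuples_update)
      then show ?thesis
        using nth_eq_iff[OF ta, of "w[i := x, j := y]" i j] that a ij u w
        by (simp add: tuples_def)
    qed
    then show ?thesis by (auto simp: chi_def fun_eq_iff)
  qed
  obtain S S' :: "'v \<Rightarrow> 'v \<Rightarrow> 'f" where S: "mat_inverses V S S'"
    and conj: "\<And>\<sigma>. \<sigma> \<in> \<gamma> ` tuples V k \<Longrightarrow>
      mat_mul V (mat_mul V S (chi V \<gamma> u i j \<sigma>)) S' = chi V \<gamma> v i j \<sigma>"
    using conj_chi[OF u v eq ij] by blast
  have "\<sigma> \<in> \<gamma> ` tuples V k" using a ta by auto
  from conj[OF this] show ?thesis
    unfolding diag[OF u] diag[OF v] by (intro card_le_of_diag_conj[OF V S]) auto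
qed

lemma card_diagonal:
  assumes "u \<in> tuples V k" "v \<in> tuples V k" "\<gamma> u = \<gamma> v" "i < k" "j < k" "i \<noteq> j"
  shows "card {x \<in> V. \<gamma> (u[i := x, j := x]) = \<sigma>} = card {x \<in> V. \<gamma> (v[i := x, j := x]) = \<sigma>}"
  using assms by (intro antisym card_diagonal_le) auto

end

text \<open>The two spare coordinates receive the new vertex; from there it is copied into any of the
  first \<open>k\<close> positions.\<close>

lemma WL_le_stable_IM:
  fixes F :: "'f::field itself"
  assumes "im_stable_graph F (k + 2) V \<Gamma> \<gamma>" and k: "k \<ge> 2"
  defines "\<delta> \<equiv> \<lambda>w. \<gamma> (w @ [last w, last w])"
  shows "lp_le (tuples V k) (WL k V \<delta>) \<delta>"
  unfolding lp_le_def
proof (intro ballI impI)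
  interpret im_stable_graph F "k + 2" V \<Gamma> \<gamma> by fact
  fix u v assume u: "u \<in> tuples V k" and v: "v \<in> tuples V k" and eq: "\<delta> u = \<delta> v"
  have ext: "w @ [x, y] \<in> tuples V (k + 2)" if "w \<in> tuples V k" "x \<in> V" "y \<in> V" for w x y
    using that by (auto simp: tuples_def)
  have last: "last w \<in> V" "last w = w ! (k - 1)" if "w \<in> tuples V k" for w
    using that k by (auto simp: tuples_def last_conv_nth)
  let ?T = "\<lambda>w x. Tuple (map (\<lambda>i. \<delta> (w[i := x])) [0..<k])"
  have len: "length w = k" if "w \<in> tuples V k" for w
    using that by (simp add: tuples_def)
  have "image_mset (\<lambda>x. \<gamma> (u @ [x, x])) (mset_set V) = image_mset (\<lambda>x. \<gamma> (v @ [x, x])) (mset_set V)"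
  proof (rule multiset_eqI)
    fix \<sigma>
    have set: "{x \<in> V. \<gamma> (w @ [x, x]) = \<sigma>} =
        {x \<in> V. \<gamma> ((w @ [last w, last w])[k := x, Suc k := x]) = \<sigma>}" if "w \<in> tuples V k" for w
      using len[OF that] by (simp add: list_update_append)
    have "card {x \<in> V. \<gamma> (u @ [x, x]) = \<sigma>} = card {x \<in> V. \<gamma> (v @ [x, x]) = \<sigma>}"
      unfolding set[OF u] set[OF v]
      by (rule card_diagonal[OF ext[OF u last(1)[OF u] last(1)[OF u]]
            ext[OF v last(1)[OF v] last(1)[OF v]] eq[unfolded \<delta>_def]]) auto
    moreover have "(\<lambda>x. \<gamma> (w @ [x, x])) -` {\<sigma>} \<inter> V = {x \<in> V. \<gamma> (w @ [x, x]) = \<sigma>}" for w by auto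
    ultimately show "count (image_mset (\<lambda>x. \<gamma> (u @ [x, x])) (mset_set V)) \<sigma> =
        count (image_mset (\<lambda>x. \<gamma> (v @ [x, x])) (mset_set V)) \<sigma>"
      using V by (simp add: count_image_mset)
  qed
  then have "image_mset (?T u) (mset_set V) = image_mset (?T v) (mset_set V)"
  proof (rule image_mset_eq_transfer)
    fix x y assume "x \<in># mset_set V" "y \<in># mset_set V" and xy: "\<gamma> (u @ [x, x]) = \<gamma> (v @ [y, y])"
    then have V: "x \<in> V" "y \<in> V" using V by auto
    have "\<delta> (u[i := x]) = \<delta> (v[i := y])" if i: "i < k" for i
    proof -
      have t: "u[i := x] \<in> tuples V k" "v[i := y] \<in> tuples V k"
        using u v V by (auto intro: tuples_update)
      \<comment> \<open>Copies the new vertex from the first spare coordinate into position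
        \<open>i\<close>.\<close>
      have "\<gamma> ((u @ [x, x])[i := (u @ [x, x]) ! k, Suc k := (u @ [x, x]) ! k]) =
          \<gamma> ((v @ [y, y])[i := (v @ [y, y]) ! k, Suc k := (v @ [y, y]) ! k])"
        by (rule label_copy[OF ext[OF u V(1) V(1)] ext[OF v V(2) V(2)] xy]) (use i in auto)
      then have copied: "\<gamma> (u[i := x] @ [x, x]) = \<gamma> (v[i := y] @ [y, y])"
        using len[OF u] len[OF v] i by (simp add: list_update_append nth_append)
      \<comment> \<open>Resets both spare coordinates to the last entry of the updated tuple, as
        \<open>\<delta>\<close> requires.\<close>
      have "\<gamma> ((u[i := x] @ [x, x])[k := (u[i := x] @ [x, x]) ! (k - 1),
            Suc k := (u[i := x] @ [x, x]) ! (k - 1)]) =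
          \<gamma> ((v[i := y] @ [y, y])[k := (v[i := y] @ [y, y]) ! (k - 1),
            Suc k := (v[i := y] @ [y, y]) ! (k - 1)])"
        by (rule label_copy[OF ext[OF t(1) V(1) V(1)] ext[OF t(2) V(2) V(2)] copied])
          (use k in auto)
      then show ?thesis
        using len[OF u] len[OF v] k t
        by (simp add: \<delta>_def list_update_append nth_append last(2))
    qed
    then show "?T u x = ?T v y" by simp
  qed
  then show "WL k V \<delta> u = WL k V \<delta> v"
    using k eq by (simp add: WL_def)
qed

lemma scheme_le_WL_IM: "scheme_le (S_WL :: 'v scheme) (S_IM (F :: 'f::field itself))"
  unfolding scheme_le_def
proof (intro allI impI)
  fix k :: nat assume k: "1 \<le> k"
  show "\<exists>k'\<ge>1. \<forall>V \<Gamma>. finite V \<and> is_graph V \<Gamma> \<longrightarrow>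
      lp_le (tuples V 2) (S_WL k V \<Gamma>) (S_IM F k' V \<Gamma> :: 'v lpart)"
  proof (cases "k = 1")
    case True
    then show ?thesis
      by (intro exI[of _ 1]) (simp add: S_WL_def S_IM_def scheme_of_def lp_le_refl)
  next
    case False
    with k have k2: "k \<ge> 2" by simp
    have "lp_le (tuples V 2) (S_WL k V \<Gamma>) (S_IM F (k + 2) V \<Gamma>)"
      if V: "finite V" and graph: "is_graph V \<Gamma>" for V :: "'v set" and \<Gamma>
    proof -
      define \<gamma> where "\<gamma> = closure_under (k + 2) (IM F (k + 2)) V (alpha (k + 2) \<Gamma>)"
      define \<delta> where "\<delta> = (\<lambda>w. \<gamma> (w @ [last w, last w]))"
      interpret im_stable_graph F "k + 2" V \<Gamma> \<gamma>
        using V k2 graph stable_closure_under[OF refinement_operator_IM V]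
          lp_le_closure_under[OF refinement_operator_IM V]
        by unfold_locales (auto simp: \<gamma>_def)
      have "lp_le (tuples V k) (WL k V \<delta>) \<delta>"
        unfolding \<delta>_def by (rule WL_le_stable_IM[OF im_stable_graph_axioms k2])
      moreover have "lp_le (tuples V k) (alpha k \<Gamma>) \<delta>"
        unfolding lp_le_def
      proof (intro ballI impI)
        fix u v assume uv: "u \<in> tuples V k" "v \<in> tuples V k" "\<delta> u = \<delta> v"
        then have len: "length u = k" "length v = k" by (auto simp: tuples_def)
        have "w @ [last w, last w] \<in> tuples V (k + 2)" if "w \<in> tuples V k" for w
          using that k2 last_in_set[of w] by (cases "w = []") (auto simp: tuples_def)
        then have "alpha (k + 2) \<Gamma> (u @ [last u, last u]) = alpha (k + 2) \<Gamma> (v @ [last v, last v])"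
          using uv by (intro lp_leD[OF alpha_le]) (auto simp: \<delta>_def)
        then have *: "i < k + 2 \<Longrightarrow> j < k + 2 \<Longrightarrow> i \<noteq> j \<Longrightarrow>
            \<Gamma> [(u @ [last u, last u]) ! i, (u @ [last u, last u]) ! j] =
            \<Gamma> [(v @ [last v, last v]) ! i, (v @ [last v, last v]) ! j]" for i j
          unfolding alpha_eq_iff by blast
        show "alpha k \<Gamma> u = alpha k \<Gamma> v"
          unfolding alpha_eq_iff
        proof (intro allI impI)
          fix i j assume "i < k" "j < k" "i \<noteq> j"
          then show "\<Gamma> [u ! i, u ! j] = \<Gamma> [v ! i, v ! j]"
            using *[of i j] len by (simp add: nth_append)
        qed
      qed
      ultimately have le: "lp_le (tuples V k) (closure_under k (WL k) V (alpha k \<Gamma>)) \<delta>"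
        by (intro closure_under_WL_le[OF V])
      show ?thesis
        unfolding lp_le_def
      proof (intro ballI impI)
        fix u v assume u: "u \<in> tuples V 2" and v: "v \<in> tuples V 2"
          and eq: "S_IM F (k + 2) V \<Gamma> u = S_IM F (k + 2) V \<Gamma> v"
        let ?e = "\<lambda>w. w @ replicate (k - 2) (last w)"
        have e: "?e w \<in> tuples V k" "S_IM F (k + 2) V \<Gamma> w = \<delta> (?e w)" if "w \<in> tuples V 2" for w
        proof -
          have w: "length w = 2" "set w \<subseteq> V" using that by (auto simp: tuples_def)
          then have "last w \<in> V" using last_in_set[of w] by (cases "w = []") auto
          then show "?e w \<in> tuples V k" using w k2 by (auto simp: tuples_def)
          have l: "last (?e w) = last w" by (simp add: last_append)
          \<comment> \<open>The \<open>k\<close> padding copies split into those that extend a pair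
            to a \<open>k\<close>-tuple and the two spare coordinates.\<close>
          have "replicate (k + 2 - 2) (last w) = replicate (k - 2) (last w) @ replicate 2 (last w)"
            using k2 by (metis add_diff_cancel_right' le_add_diff_inverse2 replicate_add)
          then show "S_IM F (k + 2) V \<Gamma> w = \<delta> (?e w)"
            unfolding \<delta>_def l
            by (simp add: S_IM_def scheme_of_def pr_def \<gamma>_def numeral_2_eq_2)
        qed
        show "S_WL k V \<Gamma> u = S_WL k V \<Gamma> v"
          using lp_leD[OF le e(1)[OF u] e(1)[OF v]] eq e(2)[OF u] e(2)[OF v] k2
          by (simp add: S_WL_def scheme_of_def pr_def)
      qed
    qed
    then show ?thesis by (intro exI[of _ "k + 2"]) simp
  qed
qed

section \<open>Criteria for equal labels and for intertwined matrices\<close>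

lemma WL_iterate_eq:
  assumes V: "finite V" and k: "k \<ge> 2"
    and init: "\<And>u v. Rel u v \<Longrightarrow> \<gamma> u = \<gamma> v"
    and step: "\<And>u v. Rel u v \<Longrightarrow>
      \<exists>f. bij_betw f V V \<and> (\<forall>x\<in>V. \<forall>i<k. Rel (u[i := x]) (v[i := f x]))"
    and "Rel u v"
  shows "(WL k V ^^ n) \<gamma> u = (WL k V ^^ n) \<gamma> v"
  using \<open>Rel u v\<close>
proof (induction n arbitrary: u v)
  case 0
  then show ?case by (simp add: init)
next
  case (Suc n)
  let ?X = "(WL k V ^^ n) \<gamma>"
  let ?T = "\<lambda>w x. Tuple (map (\<lambda>i. ?X (w[i := x])) [0..<k])"
  \<comment> \<open>\<open>Rel\<close> describes winning positions of Duplicator in the bijective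
    game. One \<open>f\<close> must serve every \<open>i\<close>, since each element of the multiset
    tries a single vertex in all coordinates.\<close>
  obtain f where f: "bij_betw f V V" "\<forall>x\<in>V. \<forall>i<k. Rel (u[i := x]) (v[i := f x])"
    using step[OF Suc.prems] by blast
  have "image_mset (?T u) (mset_set V) = image_mset (\<lambda>x. ?T v (f x)) (mset_set V)"
    using f(2) V Suc.IH by (intro image_mset_cong) auto
  also have "\<dots> = image_mset (?T v) (image_mset f (mset_set V))"
    by (simp add: multiset.map_comp comp_def)
  also have "image_mset f (mset_set V) = mset_set V"
    using f(1) by (simp add: image_mset_mset_set bij_betw_def)
  finally have "image_mset (?T u) (mset_set V) = image_mset (?T v) (mset_set V)" .
  then show ?case
    using k Suc.IH[OF Suc.prems] by (simp add: WL_def[of k V ?X])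
qed

text \<open>One \<open>S\<close> conjugates the characteristic matrices of all labels, hence also
  their linear combinations. Each \<open>\<Phi>\<close> constant on label classes gives such a
  combination, so labels may be replaced by scalars.\<close>

lemma im_equiv_intertwines:
  fixes F :: "'f::field itself"
  assumes V: "finite V" and im: "im_equiv F k V \<gamma> u v"
    and uv: "u \<in> tuples V k" "v \<in> tuples V k" and ij: "i < k" "j < k" "i \<noteq> j"
  shows "\<exists>(S :: 'v \<Rightarrow> 'v \<Rightarrow> 'f) S'. mat_inverses V S S' \<and>
    (\<forall>\<Phi>. (\<forall>a\<in>tuples V k. \<forall>b\<in>tuples V k. \<gamma> a = \<gamma> b \<longrightarrow> \<Phi> a = \<Phi> b) \<longrightarrow>
      (\<forall>x\<in>V. \<forall>y\<in>V. (\<Sum>z\<in>V. S x z * \<Phi> (u[i := z, j := y])) =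
        (\<Sum>z\<in>V. \<Phi> (v[i := x, j := z]) * S z y)))"
proof -
  obtain S S' :: "'v \<Rightarrow> 'v \<Rightarrow> 'f" where S: "mat_inverses V S S'"
    and conj: "\<And>\<sigma>. \<sigma> \<in> \<gamma> ` tuples V k \<Longrightarrow>
      mat_mul V (mat_mul V S (chi V \<gamma> u i j \<sigma>)) S' = chi V \<gamma> v i j \<sigma>"
    using im ij unfolding im_equiv_def by meson
  have "(\<Sum>z\<in>V. S x z * \<Phi> (u[i := z, j := y])) = (\<Sum>z\<in>V. \<Phi> (v[i := x, j := z]) * S z y)"
    if \<Phi>: "\<forall>a\<in>tuples V k. \<forall>b\<in>tuples V k. \<gamma> a = \<gamma> b \<longrightarrow> \<Phi> a = \<Phi> b"
      and xy: "x \<in> V" "y \<in> V" for \<Phi> :: "'v list \<Rightarrow> 'f" and x y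
  proof -
    let ?I = "\<gamma> ` tuples V k"
    define h where "h \<sigma> = \<Phi> (SOME a. a \<in> tuples V k \<and> \<gamma> a = \<sigma>)" for \<sigma>
    have h: "h (\<gamma> a) = \<Phi> a" if "a \<in> tuples V k" for a
    proof -
      have "(SOME b. b \<in> tuples V k \<and> \<gamma> b = \<gamma> a) \<in> tuples V k \<and>
          \<gamma> (SOME b. b \<in> tuples V k \<and> \<gamma> b = \<gamma> a) = \<gamma> a"
        by (rule someI[of _ a]) (use that in simp)
      then show ?thesis unfolding h_def using that by (intro \<Phi>[rule_format]) auto
    qed
    have fin: "finite ?I" using V by (simp add: finite_tuples)
    have expand: "(\<Sum>\<sigma>\<in>?I. h \<sigma> * chi V \<gamma> w i j \<sigma> p q) = \<Phi> (w[i := p, j := q])"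
      if "w \<in> tuples V k" "p \<in> V" "q \<in> V" for w p q
    proof -
      have t: "w[i := p, j := q] \<in> tuples V k" using that by (auto intro!: tuples_update)
      have "(\<Sum>\<sigma>\<in>?I. h \<sigma> * chi V \<gamma> w i j \<sigma> p q) =
          (\<Sum>\<sigma>\<in>?I. if \<sigma> = \<gamma> (w[i := p, j := q]) then h \<sigma> else 0)"
        using that by (intro sum.cong) (auto simp: chi_def)
      then show ?thesis using t fin by (simp add: sum.delta h)
    qed
    have "(\<Sum>z\<in>V. S x z * \<Phi> (u[i := z, j := y])) =
        (\<Sum>z\<in>V. \<Sum>\<sigma>\<in>?I. h \<sigma> * (S x z * chi V \<gamma> u i j \<sigma> z y))"
      using uv xy by (intro sum.cong) (auto simp: expand[symmetric] sum_distrib_left mult_ac)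
    also have "\<dots> = (\<Sum>\<sigma>\<in>?I. h \<sigma> * (\<Sum>z\<in>V. S x z * chi V \<gamma> u i j \<sigma> z y))"
      by (subst sum.swap) (simp add: sum_distrib_left)
    also have "\<dots> = (\<Sum>\<sigma>\<in>?I. h \<sigma> * (\<Sum>z\<in>V. chi V \<gamma> v i j \<sigma> x z * S z y))"
      using mat_conj_intertwines[OF V S chi_in_Mat chi_in_Mat conj xy]
      by (intro sum.cong) auto
    also have "\<dots> = (\<Sum>z\<in>V. \<Sum>\<sigma>\<in>?I. h \<sigma> * chi V \<gamma> v i j \<sigma> x z * S z y)"
      by (subst sum.swap) (simp add: sum_distrib_left mult_ac)
    also have "\<dots> = (\<Sum>z\<in>V. \<Phi> (v[i := x, j := z]) * S z y)"
      using uv xy by (intro sum.cong) (auto simp: expand[symmetric] sum_distrib_right)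
    finally show ?thesis .
  qed
  with S show ?thesis by blast
qed

section \<open>The Cai-Furer-Immerman construction over a complete bipartite graph\<close>

text \<open>A vertex \<open>(s, r, i, a)\<close> lies in copy \<open>s\<close> of the construction and in the gadget of the
  \<open>i\<close>-th base vertex on side \<open>r\<close>; the entry \<open>a j\<close> sits on the base edge to the \<open>j\<close>-th base vertex
  of the other side. Only the gadget of \<open>(True, 0)\<close> in the copy \<open>True\<close> is charged.\<close>

type_synonym 'f cfi_vertex = "bool \<times> bool \<times> nat \<times> (nat \<Rightarrow> 'f)"

definition charge :: "bool \<Rightarrow> bool \<Rightarrow> nat \<Rightarrow> 'f::field" where
  "charge s r i = of_bool (s \<and> r \<and> i = 0)"

definition cfi_vertices :: "'f::field set \<Rightarrow> nat \<Rightarrow> 'f cfi_vertex set" where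
  "cfi_vertices P n = {(s, r, i, a). i < n \<and> (\<forall>j<n. a j \<in> P) \<and> (\<forall>j\<ge>n. a j = 0) \<and>
     (\<Sum>j<n. a j) = charge s r i}"

text \<open>Only agreement of the copies is recorded, never the copy itself, so that exchanging them
  can go unnoticed. The sum \<open>a j + b i\<close> is unaffected by opposite changes of its
  terms.\<close>

fun cfi_label :: "'f::field cfi_vertex \<Rightarrow> 'f cfi_vertex \<Rightarrow> bool \<times> bool \<times> bool \<times> nat \<times> nat \<times> 'f" where
  "cfi_label (s, r, i, a) (s', r', j, b) =
     (s = s', r, r', i, j,
      if s \<noteq> s' then 0 else if r = r' then of_bool (i = j \<and> a = b) else a j + b i)"

fun gadget :: "'f cfi_vertex \<Rightarrow> bool \<times> nat" where
  "gadget (s, r, i, a) = (r, i)"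

text \<open>The opposite signs make the map its own inverse.\<close>

fun shift :: "(bool \<Rightarrow> nat \<Rightarrow> nat \<Rightarrow> 'f::field) \<Rightarrow> 'f cfi_vertex \<Rightarrow> 'f cfi_vertex" where
  "shift w (s, r, i, a) = (\<not> s, r, i, \<lambda>j. a j + (if s then - w r i j else w r i j))"

lemma finite_cfi_vertices:
  assumes "finite P"
  shows "finite (cfi_vertices P n :: 'f::field cfi_vertex set)"
proof (rule finite_subset)
  let ?A = "{a :: nat \<Rightarrow> 'f. (\<forall>j\<in>{..<n}. a j \<in> P) \<and> (\<forall>j. j \<notin> {..<n} \<longrightarrow> a j = 0)}"
  show "cfi_vertices P n \<subseteq> UNIV \<times> UNIV \<times> {..<n} \<times> ?A"
    by (auto simp: cfi_vertices_def)
  show "finite (UNIV \<times> UNIV \<times> {..<n} \<times> ?A :: 'f cfi_vertex set)"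
    using finite_set_of_finite_funs[of "{..<n}" P 0] assms
    by (intro finite_cartesian_product) (auto elim!: rev_finite_subset)
qed

text \<open>Shifts preserve gadgets, so a map glued from different flows on different gadgets is
  still injective.\<close>

lemma shift_inj: "shift w x = shift w' y \<Longrightarrow> (gadget x = gadget y \<Longrightarrow> w = w') \<Longrightarrow> x = y"
  by (cases x; cases y) (auto simp: fun_eq_iff split: if_splits)

section \<open>Flows and the movement of the hole\<close>

locale cfi =
  fixes P :: "'f::field set" and n :: nat
  assumes finite_P: "finite P" and one_P: "1 \<in> P"
    and diff_P: "\<And>x y. x \<in> P \<Longrightarrow> y \<in> P \<Longrightarrow> x - y \<in> P"
    and n: "n > 0"
begin

lemma zero_P: "0 \<in> P"
  using diff_P[OF one_P one_P] by simp

lemma uminus_P: "x \<in> P \<Longrightarrow> - x \<in> P"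
  using diff_P[OF zero_P] by force

lemma add_P: "x \<in> P \<Longrightarrow> y \<in> P \<Longrightarrow> x + y \<in> P"
  using diff_P[OF _ uminus_P] by force

lemma sum_P: "(\<And>j. j \<in> J \<Longrightarrow> f j \<in> P) \<Longrightarrow> sum f J \<in> P"
  by (induction J rule: infinite_finite_induct) (auto simp: zero_P add_P)

text \<open>Shifting along a flow turns one copy into the other everywhere outside the gadget of \<open>z\<close>,
  the hole, where the charges of the two copies fail to match.\<close>

definition flow :: "(bool \<Rightarrow> nat \<Rightarrow> nat \<Rightarrow> 'f) \<Rightarrow> bool \<times> nat \<Rightarrow> bool" where
  "flow w z \<longleftrightarrow> (\<forall>r i j. w (\<not> r) j i = - w r i j) \<and> (\<forall>r i j. w r i j \<in> P) \<and>
     (\<forall>r i j. j \<ge> n \<longrightarrow> w r i j = 0) \<and>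
     (\<forall>r i. i < n \<longrightarrow> (r, i) \<noteq> z \<longrightarrow> (\<Sum>j<n. w r i j) = charge True r i)"

lemma flowD:
  assumes "flow w z"
  shows "w (\<not> r) j i = - w r i j" "w r i j \<in> P" "j \<ge> n \<Longrightarrow> w r i j = 0"
    "i < n \<Longrightarrow> (r, i) \<noteq> z \<Longrightarrow> (\<Sum>j<n. w r i j) = charge True r i"
  using assms unfolding flow_def by blast+

text \<open>The copies differ in charge only at \<open>(True, 0)\<close>, so without any shift the
  hole is there.\<close>

lemma flow_zero: "flow (\<lambda>_ _ _. 0) (True, 0)"
  by (auto simp: flow_def zero_P charge_def)

lemma shift_cfi_vertices:
  assumes "flow w z" "x \<in> cfi_vertices P n" "gadget x \<noteq> z"
  shows "shift w x \<in> cfi_vertices P n"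
proof -
  obtain s r i a where x: "x = (s, r, i, a)" by (cases x) auto
  have "(\<Sum>j<n. a j + (if s then - w r i j else w r i j)) =
      (\<Sum>j<n. a j) + (if s then - (\<Sum>j<n. w r i j) else (\<Sum>j<n. w r i j))"
    by (simp add: sum.distrib sum_negf)
  also have "\<dots> = charge (\<not> s) r i"
    using assms(2,3) flowD(4)[OF assms(1), of i r] by (auto simp: x cfi_vertices_def charge_def)
  finally show ?thesis
    using assms(2) flowD(2,3)[OF assms(1)] by (auto simp: x cfi_vertices_def add_P uminus_P)
qed

text \<open>Antisymmetry of the flow cancels the changes at the two ends of a base edge; vertices of
  one gadget in one copy move by the same amount.\<close>

lemma cfi_label_shift:
  assumes "flow w z"
  shows "cfi_label (shift w x) (shift w y) = cfi_label x y"
proof -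
  obtain s r i a s' r' j b where xy: "x = (s, r, i, a)" "y = (s', r', j, b)"
    by (cases x; cases y) auto
  have "w r' j i = - w r i j" if "r \<noteq> r'"
  proof -
    have "r' = (\<not> r)" using that by auto
    then show ?thesis using flowD(1)[OF assms, of r j i] by simp
  qed
  then show ?thesis
    by (auto simp: xy fun_eq_iff)
qed

text \<open>The defect \<open>d\<close> travels along the base edge to \<open>(\<not> r, j)\<close>:
  balancing one end unbalances the other and touches no third gadget.\<close>

lemma flow_move_hole:
  assumes w: "flow w (r, i)" and ij: "i < n" "j < n"
  obtains w' where "flow w' (\<not> r, j)"
    "\<And>r' i'. (r', i') \<noteq> (r, i) \<Longrightarrow> (r', i') \<noteq> (\<not> r, j) \<Longrightarrow> w' r' i' = w r' i'"
proof
  define d where "d = charge True r i - (\<Sum>j<n. w r i j)"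
  define w' where "w' = (\<lambda>r' i' j'. w r' i' j' +
    (if (r', i', j') = (r, i, j) then d else if (r', i', j') = (\<not> r, j, i) then - d else 0))"
  have d: "d \<in> P"
    unfolding d_def using one_P zero_P flowD(2)[OF w]
    by (intro diff_P sum_P) (auto simp: charge_def)
  have w'_sum: "(\<Sum>j'<n. w' r' i' j') = charge True r' i'" if "i' < n" "(r', i') \<noteq> (\<not> r, j)" for r' i'
  proof (cases "(r', i') = (r, i)")
    case True
    then have "(\<Sum>j'<n. w' r' i' j') = (\<Sum>j'<n. w r i j' + (if j' = j then d else 0))"
      by (intro sum.cong) (auto simp: w'_def)
    also have "\<dots> = charge True r i"
      using ij by (simp add: sum.distrib d_def)
    finally show ?thesis using True by simp
  next
    case False
    then have "(\<Sum>j'<n. w' r' i' j') = (\<Sum>j'<n. w r' i' j')"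
      using that by (intro sum.cong) (auto simp: w'_def)
    then show ?thesis using flowD(4)[OF w] False that by simp
  qed
  have w'_skew: "w' (\<not> r') j' i' = - w' r' i' j'" for r' i' j'
    using flowD(1)[OF w, of r' j' i'] by (cases r; cases r') (simp_all add: w'_def)
  have w'_P: "w' r' i' j' \<in> P" for r' i' j'
    using flowD(2)[OF w] d by (auto simp: w'_def add_P diff_P)
  have w'_0: "w' r' i' j' = 0" if "j' \<ge> n" for r' i' j'
    using flowD(3)[OF w that] ij that by (auto simp: w'_def)
  show "flow w' (\<not> r, j)"
    unfolding flow_def
    by (intro conjI allI impI) (rule w'_skew w'_P w'_0 w'_sum; assumption)+
  show "w' r' i' = w r' i'" if "(r', i') \<noteq> (r, i)" "(r', i') \<noteq> (\<not> r, j)" for r' i'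
    using that by (auto simp: w'_def fun_eq_iff)
qed

end

section \<open>The graph and the counting game on it\<close>

locale cfi_graph = cfi P n for P :: "'f::field set" and n +
  fixes V :: "'v set" and dec :: "'v \<Rightarrow> 'f cfi_vertex" and \<Gamma> :: "'v lpart"
  assumes dec: "bij_betw dec V (cfi_vertices P n)"
    and \<Gamma>: "\<And>x y x' y'. x \<in> V \<Longrightarrow> y \<in> V \<Longrightarrow> x' \<in> V \<Longrightarrow> y' \<in> V \<Longrightarrow>
      \<Gamma> [x, y] = \<Gamma> [x', y'] \<longleftrightarrow> cfi_label (dec x) (dec y) = cfi_label (dec x') (dec y')"
begin

lemma finite_V: "finite V"
  using bij_betw_finite[OF dec] finite_cfi_vertices[OF finite_P] by blast

lemma dec_in: "x \<in> V \<Longrightarrow> dec x \<in> cfi_vertices P n"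
  using dec by (auto simp: bij_betw_def)

lemma dec_eq_iff: "x \<in> V \<Longrightarrow> y \<in> V \<Longrightarrow> dec x = dec y \<longleftrightarrow> x = y"
  using dec by (auto simp: bij_betw_def inj_on_def)

lemma inv_into_dec:
  assumes "p \<in> cfi_vertices P n"
  shows "inv_into V dec p \<in> V \<and> dec (inv_into V dec p) = p"
  using assms dec unfolding bij_betw_def by (auto intro: inv_into_into f_inv_into_f)

lemma is_graph: "is_graph V \<Gamma>"
  unfolding is_graph_def
proof (intro ballI impI)
  fix u v w assume uvw: "u \<in> V" "v \<in> V" "w \<in> V" "v \<noteq> w"
  then have "dec v \<noteq> dec w" by (simp add: dec_eq_iff)
  then have "cfi_label (dec u) (dec u) \<noteq> cfi_label (dec v) (dec w)"
    by (cases "dec u"; cases "dec v"; cases "dec w") auto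
  then show "\<Gamma> [u, u] \<noteq> \<Gamma> [v, w]" using uvw \<Gamma> by simp
qed

text \<open>Winning positions of Duplicator: the mismatch of charges is confined to a gadget without
  pebbles.\<close>

definition wl_rel :: "nat \<Rightarrow> 'v list \<Rightarrow> 'v list \<Rightarrow> bool" where
  "wl_rel k u v \<longleftrightarrow> u \<in> tuples V k \<and> v \<in> tuples V k \<and>
     (\<exists>w z. flow w z \<and>
       (\<forall>l<k. gadget (dec (u ! l)) \<noteq> z \<and> dec (v ! l) = shift w (dec (u ! l))))"

lemma wl_rel_alpha:
  assumes "wl_rel k u v"
  shows "alpha k \<Gamma> u = alpha k \<Gamma> v"
  unfolding alpha_eq_iff
  using assms by (auto simp: wl_rel_def \<Gamma> tuples_nth cfi_label_shift)

lemma wl_rel_step: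
  assumes rel: "wl_rel k u v" and k: "k < n"
  shows "\<exists>f. bij_betw f V V \<and> (\<forall>x\<in>V. \<forall>l<k. wl_rel k (u[l := x]) (v[l := f x]))"
proof -
  obtain w z where uv: "u \<in> tuples V k" "v \<in> tuples V k" and w: "flow w z"
    and nz: "\<And>l. l < k \<Longrightarrow> gadget (dec (u ! l)) \<noteq> z"
    and sh: "\<And>l. l < k \<Longrightarrow> dec (v ! l) = shift w (dec (u ! l))"
    using rel by (auto simp: wl_rel_def)
  have len: "length u = k" "length v = k" using uv by (auto simp: tuples_def)
  obtain r i where z: "z = (r, i)" by (cases z)
  \<comment> \<open>Pigeonhole: the side opposite to the hole has \<open>n > k\<close>
    gadgets.\<close>
  have "\<exists>j<n. \<forall>l<k. gadget (dec (u ! l)) \<noteq> (\<not> r, j)"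
  proof (rule ccontr)
    assume "\<not> ?thesis"
    then have "{..<n} \<subseteq> (\<lambda>l. snd (gadget (dec (u ! l)))) ` {..<k}"
      by (force simp: image_iff)
    then have "n \<le> k"
      using surj_card_le[of "{..<k}" "{..<n}"] by simp
    then show False using k by simp
  qed
  then obtain j where j: "j < n" "\<And>l. l < k \<Longrightarrow> gadget (dec (u ! l)) \<noteq> (\<not> r, j)" by blast
  \<comment> \<open>A hole with \<open>i \<ge> n\<close> contains no vertex and need not move, hence
    the premises \<open>i < n\<close>.\<close>
  obtain w' where w': "i < n \<Longrightarrow> flow w' (\<not> r, j)"
    "\<And>r' i'. i < n \<Longrightarrow> (r', i') \<noteq> (r, i) \<Longrightarrow> (r', i') \<noteq> (\<not> r, j) \<Longrightarrow> w' r' i' = w r' i'"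
  proof (cases "i < n")
    case True
    then show ?thesis using flow_move_hole[of w r i j] w j z that by metis
  qed (use that in blast)
  \<comment> \<open>Vertices in the gadget of the hole follow \<open>w'\<close>, whose hole is
    elsewhere; all others follow \<open>w\<close>.\<close>
  define g where "g p = shift (if gadget p = z then w' else w) p" for p
  have gz: "i < n" if "p \<in> cfi_vertices P n" "gadget p = z" for p
    using that by (cases p) (auto simp: cfi_vertices_def z)
  have g_in: "g p \<in> cfi_vertices P n" if "p \<in> cfi_vertices P n" for p
    using shift_cfi_vertices[OF w that] shift_cfi_vertices[OF w'(1)[OF gz[OF that]] that] z
    by (auto simp: g_def)
  have inj_g: "inj_on g (cfi_vertices P n)"
  proof (rule inj_onI)
    fix p q assume "g p = g q"
    then show "p = q" unfolding g_def by (rule shift_inj) simp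
  qed
  define f where "f x = inv_into V dec (g (dec x))" for x
  have df: "f x \<in> V" "dec (f x) = g (dec x)" if "x \<in> V" for x
    using inv_into_dec[OF g_in[OF dec_in[OF that]]] by (auto simp: f_def)
  have "inj_on f V"
  proof (rule inj_onI)
    fix x y assume xy: "x \<in> V" "y \<in> V" "f x = f y"
    then have "g (dec x) = g (dec y)" using df by metis
    then show "x = y" using inj_g xy dec_in dec_eq_iff by (metis inj_onD)
  qed
  then have "bij_betw f V V"
    unfolding bij_betw_def using df(1) finite_V endo_inj_surj[of V f] by blast
  moreover have "wl_rel k (u[l := x]) (v[l := f x])" if x: "x \<in> V" and l: "l < k" for x l
  proof -
    have t: "u[l := x] \<in> tuples V k" "v[l := f x] \<in> tuples V k"
      using uv x df by (auto intro: tuples_update)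
    have "\<exists>w z. flow w z \<and> (\<forall>m<k. gadget (dec (u[l := x] ! m)) \<noteq> z \<and>
        dec (v[l := f x] ! m) = shift w (dec (u[l := x] ! m)))"
    proof (cases "gadget (dec x) = z")
      case False
      have "flow w z \<and> (\<forall>m<k. gadget (dec (u[l := x] ! m)) \<noteq> z \<and>
          dec (v[l := f x] ! m) = shift w (dec (u[l := x] ! m)))"
        using w nz sh False df[OF x] len l by (auto simp: nth_list_update g_def)
      then show ?thesis by blast
    next
      case True
      then have i: "i < n" using gz dec_in x by blast
      have same: "shift w' (dec (u ! m)) = shift w (dec (u ! m))" if "m < k" for m
        using w'(2)[OF i] nz[OF that] j(2)[OF that] z by (cases "dec (u ! m)") auto
      have "flow w' (\<not> r, j) \<and> (\<forall>m<k. gadget (dec (u[l := x] ! m)) \<noteq> (\<not> r, j) \<and>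
          dec (v[l := f x] ! m) = shift w' (dec (u[l := x] ! m)))"
        using w'(1)[OF i] j(2) sh same True df[OF x] len l z by (auto simp: nth_list_update g_def)
      then show ?thesis by blast
    qed
    then show ?thesis using t by (simp add: wl_rel_def)
  qed
  ultimately show ?thesis by blast
qed

lemma S_WL_eq:
  assumes k: "k \<ge> 1" "k < n" and V: "x \<in> V" "y \<in> V"
    and dx: "dec x = (False, False, 0, \<lambda>_. 0)" and dy: "dec y = (True, False, 0, \<lambda>_. 0)"
  shows "S_WL k V \<Gamma> [x, x] = S_WL k V \<Gamma> [y, y]"
proof (cases "k = 1")
  case True
  then show ?thesis using V by (simp add: S_WL_def scheme_of_def \<Gamma> dx dy)
next
  case False
  with k have k2: "k \<ge> 2" by simp
  \<comment> \<open>The zero flow sends \<open>x\<close> to \<open>y\<close>, which lie on side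
    \<open>False\<close>, away from the hole.\<close>
  have "flow (\<lambda>_ _ _. 0) (True, 0)" by (rule flow_zero)
  moreover have "(x # x # replicate (k - 2) x) ! l = x" "(y # y # replicate (k - 2) y) ! l = y"
    if "l < k" for l
    using that by (auto simp: nth_Cons' nth_append)
  ultimately have "wl_rel k (x # x # replicate (k - 2) x) (y # y # replicate (k - 2) y)"
    unfolding wl_rel_def using V k2 by (auto simp: tuples_def dx dy)
  then show ?thesis
    using WL_iterate_eq[OF finite_V k2 wl_rel_alpha wl_rel_step] k2 k
    by (simp add: S_WL_def scheme_of_def pr_def closure_under_def)
qed

text \<open>Let \<open>S\<close> intertwine the matrices with entries \<open>a j + b i\<close> between the gadgets \<open>(True, i)\<close> and
  \<open>(False, j)\<close> of the two copies. Then \<open>S\<close> sends the indicator of a gadget to \<open>\<kappa>\<close> times the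
  indicator of its twin, and the function \<open>a j\<close> to \<open>\<kappa> a j\<close> plus a constant \<open>m i j\<close>, which is also
  the constant obtained from the transposed action on \<open>b i\<close>. Summing over \<open>i\<close> and \<open>j\<close> in both
  orders compares the charges of the two sides and yields \<open>\<kappa> = 0\<close>.\<close>

lemma not_im_equiv:
  assumes le: "lp_le (tuples V 3) (alpha 3 \<Gamma>) \<gamma>" and V: "x \<in> V" "y \<in> V"
    and dx: "dec x = (False, False, 0, \<lambda>_. 0)" and dy: "dec y = (True, False, 0, \<lambda>_. 0)"
  shows "\<not> im_equiv TYPE('f) 3 V \<gamma> [x, x, x] [y, y, y]"
proof
  assume im: "im_equiv TYPE('f) 3 V \<gamma> [x, x, x] [y, y, y]"
  have t: "[x, x, x] \<in> tuples V 3" "[y, y, y] \<in> tuples V 3" using V by (auto simp: tuples_def)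
  obtain S S' :: "'v \<Rightarrow> 'v \<Rightarrow> 'f" where S: "mat_inverses V S S'"
    and tw: "\<forall>\<Phi>. (\<forall>a\<in>tuples V 3. \<forall>b\<in>tuples V 3. \<gamma> a = \<gamma> b \<longrightarrow> \<Phi> a = \<Phi> b) \<longrightarrow>
      (\<forall>p\<in>V. \<forall>q\<in>V. (\<Sum>z\<in>V. S p z * \<Phi> ([x, x, x][0 := z, 1 := q])) =
        (\<Sum>z\<in>V. \<Phi> ([y, y, y][0 := p, 1 := z]) * S z q))"
    using im_equiv_intertwines[OF finite_V im t, of 0 1] by auto
  define copy where "copy p = fst (dec p)" for p
  define val where "val p = snd (snd (snd (dec p)))" for p
  define In :: "bool \<Rightarrow> bool \<Rightarrow> nat \<Rightarrow> 'v \<Rightarrow> 'f"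
    where "In s r i p = of_bool (copy p = s \<and> gadget (dec p) = (r, i))" for s r i p
  have twist: "(\<Sum>z\<in>V. S p z * (In False True i z * In False False j q * g (val z j + val q i))) =
      (\<Sum>z\<in>V. (In True True i p * In True False j z * g (val p j + val z i)) * S z q)"
    if "p \<in> V" "q \<in> V" for p q i j and g :: "'f \<Rightarrow> 'f"
  proof -
    \<comment> \<open>The third entry stays \<open>x\<close> or \<open>y\<close>. Labels show only
      whether copies agree, so \<open>\<Phi>\<close> refers to the copy of
      \<open>a ! 2\<close>.\<close>
    define \<Phi> where "\<Phi> a = In (copy (a ! 2)) True i (a ! 0) * In (copy (a ! 2)) False j (a ! 1) *
      g (val (a ! 0) j + val (a ! 1) i)" for a
    have "\<Phi> a = \<Phi> b" if ab: "a \<in> tuples V 3" "b \<in> tuples V 3" "\<gamma> a = \<gamma> b" for a b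
    proof -
      have "alpha 3 \<Gamma> a = alpha 3 \<Gamma> b" using ab by (rule lp_leD[OF le])
      then have lab: "cfi_label (dec (a ! l)) (dec (a ! m)) = cfi_label (dec (b ! l)) (dec (b ! m))"
        if "l < 3" "m < 3" "l \<noteq> m" for l m
        using that ab(1,2) \<Gamma>[OF tuples_nth[OF ab(1) that(1)] tuples_nth[OF ab(1) that(2)]
            tuples_nth[OF ab(2) that(1)] tuples_nth[OF ab(2) that(2)]]
        unfolding alpha_eq_iff by blast
      show ?thesis
        using lab[of 0 1] lab[of 0 2] lab[of 1 2]
        by (cases "dec (a ! 0)"; cases "dec (a ! 1)"; cases "dec (a ! 2)";
            cases "dec (b ! 0)"; cases "dec (b ! 1)"; cases "dec (b ! 2)")
          (auto simp: \<Phi>_def In_def copy_def val_def split: if_splits)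
    qed
    then have "(\<Sum>z\<in>V. S p z * \<Phi> ([x, x, x][0 := z, 1 := q])) =
        (\<Sum>z\<in>V. \<Phi> ([y, y, y][0 := p, 1 := z]) * S z q)"
      using tw that by blast
    then show ?thesis
      by (simp add: \<Phi>_def copy_def dx dy numeral_2_eq_2)
  qed
  \<comment> \<open>Values with the sums prescribed for side \<open>True\<close> of copy
    \<open>True\<close>, so that the vertices \<open>X i\<close> exist.\<close>
  define a :: "nat \<Rightarrow> nat \<Rightarrow> 'f" where "a i = (\<lambda>j. of_bool (i = 0 \<and> j = 0))" for i
  have sum_a: "(\<Sum>j<n. a i j) = of_bool (i = 0)" for i
    using n by (cases "i = 0") (auto simp: a_def of_bool_def sum.delta)
  define X where "X i = inv_into V dec (True, True, i, a i)" for i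
  define Y where "Y r i = inv_into V dec (False, r, i, \<lambda>_. 0)" for r i
  have X: "X i \<in> V \<and> dec (X i) = (True, True, i, a i)" if "i < n" for i
    unfolding X_def using that n zero_P one_P sum_a[of i]
    by (intro inv_into_dec) (auto simp: cfi_vertices_def charge_def a_def)
  have Y: "Y r i \<in> V \<and> dec (Y r i) = (False, r, i, \<lambda>_. 0)" if "i < n" for r i
    unfolding Y_def using that zero_P by (intro inv_into_dec) (auto simp: cfi_vertices_def charge_def)
  \<comment> \<open>\<open>R\<close> and \<open>L\<close> apply \<open>S\<close> and its transpose
    to indicators of gadgets; \<open>A\<close> and \<open>B\<close> weight these by the entry on one
    base edge.\<close>
  define R where "R i p = (\<Sum>z\<in>V. S p z * In False True i z)" for i p
  define L where "L j q = (\<Sum>z\<in>V. In True False j z * S z q)" for j q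
  define A where "A i j p = (\<Sum>z\<in>V. S p z * In False True i z * val z j)" for i j p
  define B where "B i j q = (\<Sum>z\<in>V. In True False j z * val z i * S z q)" for i j q
  \<comment> \<open>For constant \<open>g\<close> both sides separate into a function of
    \<open>p\<close> times one of \<open>q\<close>.\<close>
  have RL: "R i p * In False False j q = In True True i p * L j q" if "p \<in> V" "q \<in> V" for i j p q
    using twist[OF that, of i j "\<lambda>_. 1"]
    by (simp add: R_def L_def sum_distrib_left sum_distrib_right mult_ac)
  define \<kappa> where "\<kappa> = R 0 (X 0)"
  \<comment> \<open>In the complete bipartite base graph every \<open>i\<close> meets every
    \<open>j\<close>, so a single \<open>\<kappa>\<close> serves all gadgets.\<close>
  have RX: "R i (X i) = L j (Y False j)" if "i < n" "j < n" for i j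
    using RL[of "X i" "Y False j" i j] X[OF that(1)] Y[OF that(2), of False]
    by (simp add: In_def copy_def)
  have L\<kappa>: "L j (Y False j) = \<kappa>" if "j < n" for j
    using RX[OF n that] by (simp add: \<kappa>_def)
  have R\<kappa>: "R i (X i) = \<kappa>" if "i < n" for i
    using RX[OF that n] L\<kappa>[OF n] by simp
  have AB: "A i j (X i) - \<kappa> * a i j = B i j (Y False j)" if ij: "i < n" "j < n" for i j
  proof -
    have XY: "X i \<in> V" "Y False j \<in> V" using X Y ij by auto
    have val: "val (X i) j = a i j" "val (Y False j) i = 0"
      using X[OF ij(1)] Y[OF ij(2)] by (auto simp: val_def)
    have In: "In True True i (X i) = 1" "In False False j (Y False j) = 1"
      using X[OF ij(1)] Y[OF ij(2)] by (auto simp: In_def copy_def)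
    have "A i j (X i) = a i j * L j (Y False j) + B i j (Y False j)"
      using twist[OF XY, of i j "\<lambda>c. c"]
      by (simp add: val In A_def B_def L_def algebra_simps sum.distrib sum_distrib_left)
    then show ?thesis using L\<kappa>[OF ij(2)] by simp
  qed
  have val_sum: "(\<Sum>j<n. val z j) = charge (copy z) (fst (gadget (dec z))) (snd (gadget (dec z)))"
    if "z \<in> V" for z
    using dec_in[OF that] by (cases "dec z") (auto simp: cfi_vertices_def val_def copy_def)
  \<comment> \<open>Copy \<open>False\<close> carries no charge.\<close>
  have sum_A: "(\<Sum>j<n. A i j p) = 0" for i p
  proof -
    have "(\<Sum>j<n. A i j p) = (\<Sum>z\<in>V. S p z * In False True i z * (\<Sum>j<n. val z j))"
      unfolding A_def by (subst sum.swap) (simp add: sum_distrib_left)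
    also have "\<dots> = 0"
      by (rule sum.neutral) (auto simp: val_sum In_def charge_def)
    finally show ?thesis .
  qed
  \<comment> \<open>Side \<open>False\<close> carries no charge, even in copy
    \<open>True\<close>.\<close>
  have sum_B: "(\<Sum>i<n. B i j q) = 0" for j q
  proof -
    have "(\<Sum>i<n. B i j q) = (\<Sum>z\<in>V. In True False j z * (\<Sum>i<n. val z i) * S z q)"
      unfolding B_def by (subst sum.swap) (simp add: sum_distrib_left sum_distrib_right)
    also have "\<dots> = 0"
      by (rule sum.neutral) (auto simp: val_sum In_def charge_def)
    finally show ?thesis .
  qed
  have "(\<Sum>i<n. \<Sum>j<n. A i j (X i) - \<kappa> * a i j) = (\<Sum>i<n. \<Sum>j<n. B i j (Y False j))"
    by (intro sum.cong refl) (simp add: AB)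
  moreover have "(\<Sum>i<n. \<Sum>j<n. B i j (Y False j)) = 0"
    by (subst sum.swap) (simp add: sum_B)
  \<comment> \<open>The entries \<open>a i j\<close> add up to the single charge 1.\<close>
  moreover have "(\<Sum>i<n. \<Sum>j<n. A i j (X i) - \<kappa> * a i j) = - \<kappa>"
    using n by (simp add: sum_subtractf sum_A sum_a sum_negf of_bool_def sum.delta flip: sum_distrib_left)
  ultimately have "\<kappa> = 0" by simp
  \<comment> \<open>So \<open>S\<close> kills the indicator of the gadget \<open>(True, 0)\<close>
    of copy \<open>False\<close>. It is nonzero at \<open>q\<close> below, against
    \<open>S' S = 1\<close>.\<close>
  have R0: "R 0 p = 0" if "p \<in> V" for p
  proof -
    have "R 0 p = In True True 0 p * L 0 (Y False 0)"
      using RL[OF that, of "Y False 0" 0 0] Y[OF n, of False] by (simp add: In_def copy_def)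
    then show ?thesis using L\<kappa>[OF n] \<open>\<kappa> = 0\<close> by simp
  qed
  define q where "q = Y True 0"
  have q: "q \<in> V" "In False True 0 q = 1" using Y[OF n, of True] by (auto simp: q_def In_def copy_def)
  have one: "(\<Sum>p\<in>V. S' q p * S p z) = (if z = q then 1 else 0)" if "z \<in> V" for z
  proof -
    have "mat_mul V S' S q z = mat_one V q z"
      using S by (simp add: mat_inverses_def)
    then show ?thesis
      using q(1) that by (auto simp: mat_mul_def mat_one_def)
  qed
  have "0 = (\<Sum>p\<in>V. S' q p * R 0 p)" using R0 by simp
  also have "\<dots> = (\<Sum>z\<in>V. (\<Sum>p\<in>V. S' q p * S p z) * In False True 0 z)"
    unfolding R_def sum_distrib_left sum_distrib_right
    by (subst sum.swap) (simp add: mult_ac)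
  also have "\<dots> = (\<Sum>z\<in>V. if z = q then In False True 0 z else 0)"
    by (intro sum.cong) (auto simp: one)
  also have "\<dots> = 1" using q finite_V by (simp add: sum.delta)
  finally show False by simp
qed

lemma S_IM_neq:
  assumes V: "x \<in> V" "y \<in> V"
    and dx: "dec x = (False, False, 0, \<lambda>_. 0)" and dy: "dec y = (True, False, 0, \<lambda>_. 0)"
  shows "S_IM TYPE('f) 3 V \<Gamma> [x, x] \<noteq> S_IM TYPE('f) 3 V \<Gamma> [y, y]"
proof
  define \<gamma> where "\<gamma> = closure_under 3 (IM TYPE('f) 3) V (alpha 3 \<Gamma>)"
  assume "S_IM TYPE('f) 3 V \<Gamma> [x, x] = S_IM TYPE('f) 3 V \<Gamma> [y, y]"
  then have "\<gamma> [x, x, x] = \<gamma> [y, y, y]"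
    by (simp add: S_IM_def scheme_of_def pr_def \<gamma>_def)
  moreover have "[x, x, x] \<in> tuples V 3" "[y, y, y] \<in> tuples V 3" using V by (auto simp: tuples_def)
  moreover have "stable 3 (IM TYPE('f) 3) V \<gamma>"
    unfolding \<gamma>_def by (rule stable_closure_under[OF refinement_operator_IM finite_V])
  ultimately have "im_equiv TYPE('f) 3 V \<gamma> [x, x, x] [y, y, y]"
    by (intro stable_IM_im_equiv[OF finite_V]) auto
  moreover have "lp_le (tuples V 3) (alpha 3 \<Gamma>) \<gamma>"
    unfolding \<gamma>_def by (rule lp_le_closure_under[OF refinement_operator_IM finite_V])
  ultimately show False using not_im_equiv assms by blast
qed

end

section \<open>The prime field and strictness\<close>

lemma finite_range_of_int:
  assumes "CHAR('f::field) > 0"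
  shows "finite (range (of_int :: int \<Rightarrow> 'f))"
proof (rule finite_subset)
  \<comment> \<open>Integers act through their residues modulo the characteristic, whose positivity
    leaves finitely many.\<close>
  have "of_int i = (of_int (i mod int CHAR('f)) :: 'f)" for i
  proof -
    have "(of_int i :: 'f) = of_int (int CHAR('f) * (i div int CHAR('f)) + i mod int CHAR('f))"
      by simp
    also have "\<dots> = of_int (i mod int CHAR('f))"
      by (simp only: of_int_add of_int_mult of_int_of_nat_eq of_nat_CHAR) simp
    finally show ?thesis .
  qed
  then show "range (of_int :: int \<Rightarrow> 'f) \<subseteq> of_int ` {0..<int CHAR('f)}"
    using assms by (metis image_eqI image_subsetI atLeastLessThan_iff of_nat_0_less_iff
        pos_mod_bound pos_mod_sign)
qed simp

lemma ex_cfi_graph: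
  assumes "CHAR('f::field) > 0" "n > 0"
  shows "\<exists>V dec (\<Gamma> :: ('v::infinite) lpart). cfi_graph (range of_int :: 'f set) n V dec \<Gamma>"
proof -
  let ?P = "range of_int :: 'f set"
  let ?C = "cfi_vertices ?P n"
  have P: "finite ?P" using assms(1) by (rule finite_range_of_int)
  have C: "finite ?C" using P by (rule finite_cfi_vertices)
  obtain V :: "'v set" where V: "finite V" "card V = card ?C"
    using infinite_arbitrarily_large[OF infinite_UNIV] by metis
  then obtain dec where dec: "bij_betw dec V ?C"
    using C finite_same_card_bij by metis
  \<comment> \<open>Only finitely many labels occur, so they can be numbered and turned into
    atoms.\<close>
  have "finite ((\<lambda>(p, q). cfi_label p q) ` (?C \<times> ?C))" using C by simp
  then obtain enc :: "_ \<Rightarrow> nat" where enc: "inj_on enc ((\<lambda>(p, q). cfi_label p q) ` (?C \<times> ?C))"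
    using finite_imp_inj_to_nat_seg by metis
  define \<Gamma> :: "'v lpart" where "\<Gamma> v = Atom (enc (cfi_label (dec (v ! 0)) (dec (v ! 1))))" for v
  have "cfi_graph ?P n V dec \<Gamma>"
  proof
    show "finite ?P" "n > 0" by (fact P assms(2))+
    show "1 \<in> ?P" by (rule image_eqI[of _ _ 1]) auto
    show "bij_betw dec V ?C" by fact
    show "x - y \<in> ?P" if "x \<in> ?P" "y \<in> ?P" for x y
      using that by (auto simp flip: of_int_diff)
    fix x y x' y' assume "x \<in> V" "y \<in> V" "x' \<in> V" "y' \<in> V"
    then have "dec x \<in> ?C" "dec y \<in> ?C" "dec x' \<in> ?C" "dec y' \<in> ?C"
      using dec by (auto simp: bij_betw_def)
    then have "enc (cfi_label (dec x) (dec y)) = enc (cfi_label (dec x') (dec y')) \<longleftrightarrow>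
        cfi_label (dec x) (dec y) = cfi_label (dec x') (dec y')"
      by (intro inj_on_eq_iff[OF enc]) auto
    then show "\<Gamma> [x, y] = \<Gamma> [x', y'] \<longleftrightarrow> cfi_label (dec x) (dec y) = cfi_label (dec x') (dec y')"
      by (simp add: \<Gamma>_def)
  qed
  then show ?thesis by blast
qed

lemma not_scheme_le_IM_WL:
  assumes "CHAR('f::field) > 0"
  shows "\<not> scheme_le (S_IM TYPE('f) :: ('v::infinite) scheme) S_WL"
proof
  assume "scheme_le (S_IM TYPE('f) :: 'v scheme) S_WL"
  \<comment> \<open>Dimension 3 is the least at which \<open>IM\<close> differs from the
    identity.\<close>
  then have "\<exists>k\<ge>1. \<forall>V \<Gamma>. finite V \<and> is_graph V \<Gamma> \<longrightarrow>
      lp_le (tuples V 2) (S_IM TYPE('f) 3 V \<Gamma>) (S_WL k V \<Gamma> :: 'v lpart)"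
    unfolding scheme_le_def by (rule allE[where x = 3]) simp
  then obtain k where k: "k \<ge> 1" and le: "\<And>V \<Gamma>. finite V \<Longrightarrow> is_graph V \<Gamma> \<Longrightarrow>
      lp_le (tuples V 2) (S_IM TYPE('f) 3 V \<Gamma>) (S_WL k V \<Gamma> :: 'v lpart)"
    by blast
  \<comment> \<open>With \<open>Suc k\<close> gadgets per side, \<open>k\<close> pebbles cannot
    cover a side.\<close>
  obtain V dec and \<Gamma> :: "'v lpart"
    where "cfi_graph (range of_int :: 'f set) (Suc k) V dec \<Gamma>"
    using ex_cfi_graph[OF assms, of "Suc k"] by auto
  then interpret cfi_graph "range of_int :: 'f set" "Suc k" V dec \<Gamma> .
  have "(s, False, 0, \<lambda>_. 0) \<in> cfi_vertices (range of_int :: 'f set) (Suc k)" for s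
    by (auto simp: cfi_vertices_def charge_def zero_P)
  then obtain x y where xy: "x \<in> V" "y \<in> V"
    "dec x = (False, False, 0, \<lambda>_. 0)" "dec y = (True, False, 0, \<lambda>_. 0)"
    using inv_into_dec by blast
  have "S_WL k V \<Gamma> [x, x] = S_WL k V \<Gamma> [y, y]"
    using k xy by (intro S_WL_eq) auto
  then have "S_IM TYPE('f) 3 V \<Gamma> [x, x] = S_IM TYPE('f) 3 V \<Gamma> [y, y]"
    using xy(1,2) by (intro lp_leD[OF le[OF finite_V is_graph]]) (auto simp: tuples_def)
  then show False using S_IM_neq[OF xy] by simp
qed

theorem theorem3:
  assumes "CHAR('f::field) > 0"
  shows "scheme_le (S_WL :: ('v::infinite) scheme) (S_IM TYPE('f)) \<and>
         \<not> scheme_le (S_IM TYPE('f) :: 'v scheme) S_WL"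
  using scheme_le_WL_IM not_scheme_le_IM_WL[OF assms] by blast

end
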